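(* Let $M$ be a connected and locally compact metric space and suppose that $K$ is an isolated invariant continuum of a flow $\varphi$ on $M$ such that $K$ disconnects a connected neighborhood $W$ of $K$ in $M$ into two components (i.e. $W-K$ has exactly two connected components). If $CH_{+}^{1}(K)$ and $CH_{-}^{1}(K)$ are trivial, then $K$ is non-saddle and it is neither an attractor nor a repeller. Moreover, if $M$ is a compact manifold without boundary such that $K$ does not disconnect $M$, then $H^{1}(M)\neq\{0\}$.
   Context: A flow is a continuous action $\varphi:M\times\mathbb{R}\to M$; write $xt=\varphi(x,t)$, $\gamma^+(x)=\{xt\mid t\ge 0\}$, $\gamma^-(x)=\{xt\mid t\le 0\}$. A continuum is a compact connected set. An isolated invariant set is a compact invariant set $K$ (with $\emptyset\neq K\subsetneq M$) having an isolating neighborhood, i.e. a compact neighborhood $N$ such that $K$ is the maximal invariant set in $N$. An isolating block is an isolating neighborhood $N$ for which there are compact sets $N^i,N^o\subset\partial N$ (entrance and exit sets) such that: (1) $\partial N=N^i\cup N^o$; (2) for each $x\in N^i$ there is $\varepsilon>0$ with $x[-\varepsilon,0)\subset M-N$, and for each $x\in N^o$ there is $\delta>0$ with $x(0,\delta]\subset M-N$; (3) for each $x\in\partial N-N^i$ there is $\varepsilon>0$ with $x[-\varepsilon,0)\subset\mathring{N}$, and for each $x\in\partial N-N^o$ there is $\delta>0$ with $x(0,\delta]\subset\mathring{N}$. Isolating blocks form a neighborhood basis of $K$. The Conley index $h^+(K)$ is the pointed homotopy type of $(N/N^o,[N^o])$ and the negative Conley index $h^-(K)$ is that of $(N/N^i,[N^i])$,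 for any isolating block $N$ of $K$. The cohomological indices are $CH_\pm^*(K)=\check{H}^*(h^\pm(K))$ ($\check{H}^*$ is Čech cohomology with integer coefficients); thus $CH_+^*(K)\cong\check{H}^*(N,N^o)$ and $CH_-^*(K)\cong\check{H}^*(N,N^i)$. A compact invariant set $K$ is saddle if it admits a neighborhood $U$ such that every neighborhood $V$ of $K$ contains a point $x\in V$ with $\gamma^+(x)\nsubseteq U$ and $\gamma^-(x)\nsubseteq U$; otherwise it is non-saddle. An attractor is an asymptotically stable compact invariant set; a repeller is one that is asymptotically stable for the reversed flow. $H^*$ denotes singular cohomology with integer coefficients. *)

theory Defs
  imports "HOL-Analysis.Analysis" "HOL-Homology.Homology"
begin

section \<open>Flows\<close>

definition flow :: "('a::metric_space \<Rightarrow> real \<Rightarrow> 'a) \<Rightarrow> bool" where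
  "flow \<phi> \<longleftrightarrow>
     continuous_on UNIV (\<lambda>(x, t). \<phi> x t) \<and>
     (\<forall>x. \<phi> x 0 = x) \<and>
     (\<forall>x s t. \<phi> (\<phi> x s) t = \<phi> x (s + t))"

definition reverse_flow :: "('a \<Rightarrow> real \<Rightarrow> 'a) \<Rightarrow> 'a \<Rightarrow> real \<Rightarrow> 'a" where
  "reverse_flow \<phi> x t = \<phi> x (- t)"

definition forward_orbit :: "('a \<Rightarrow> real \<Rightarrow> 'a) \<Rightarrow> 'a \<Rightarrow> 'a set" where
  "forward_orbit \<phi> x = {\<phi> x t | t. t \<ge> 0}"

definition backward_orbit :: "('a \<Rightarrow> real \<Rightarrow> 'a) \<Rightarrow> 'a \<Rightarrow> 'a set" where
  "backward_orbit \<phi> x = {\<phi> x t | t. t \<le> 0}"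

definition invariant :: "('a \<Rightarrow> real \<Rightarrow> 'a) \<Rightarrow> 'a set \<Rightarrow> bool" where
  "invariant \<phi> S \<longleftrightarrow> (\<forall>x\<in>S. \<forall>t. \<phi> x t \<in> S)"

text \<open>Neighborhoods of a set are not required to be open.\<close>

definition neighborhood :: "'a::topological_space set \<Rightarrow> 'a set \<Rightarrow> bool" where
  "neighborhood K U \<longleftrightarrow> K \<subseteq> interior U"

definition isolating_neighborhood ::
    "('a::metric_space \<Rightarrow> real \<Rightarrow> 'a) \<Rightarrow> 'a set \<Rightarrow> 'a set \<Rightarrow> bool" where
  "isolating_neighborhood \<phi> K N \<longleftrightarrow>
     compact N \<and> neighborhood K N \<and>
     invariant \<phi> K \<and> (\<forall>S. invariant \<phi> S \<and> S \<subseteq> N \<longrightarrow> S \<subseteq> K)"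

definition isolated_invariant_set ::
    "('a::metric_space \<Rightarrow> real \<Rightarrow> 'a) \<Rightarrow> 'a set \<Rightarrow> bool" where
  "isolated_invariant_set \<phi> K \<longleftrightarrow>
     compact K \<and> invariant \<phi> K \<and> K \<noteq> {} \<and> K \<noteq> UNIV \<and>
     (\<exists>N. isolating_neighborhood \<phi> K N)"

text \<open>\<open>isolating_block \<phi> K N Ni No\<close>: \<open>N\<close> is an isolating block of \<open>K\<close> with entrance set \<open>Ni\<close> and
  exit set \<open>No\<close>.\<close>

definition isolating_block ::
    "('a::metric_space \<Rightarrow> real \<Rightarrow> 'a) \<Rightarrow> 'a set \<Rightarrow> 'a set \<Rightarrow> 'a set \<Rightarrow> 'a set \<Rightarrow> bool" where
  "isolating_block \<phi> K N Ni No \<longleftrightarrow>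
     isolating_neighborhood \<phi> K N \<and>
     compact Ni \<and> compact No \<and> frontier N = Ni \<union> No \<and>
     (\<forall>x\<in>Ni. \<exists>\<epsilon>>0. \<forall>t\<in>{-\<epsilon>..<0}. \<phi> x t \<notin> N) \<and>
     (\<forall>x\<in>No. \<exists>\<delta>>0. \<forall>t\<in>{0<..\<delta>}. \<phi> x t \<notin> N) \<and>
     (\<forall>x\<in>frontier N - Ni. \<exists>\<epsilon>>0. \<forall>t\<in>{-\<epsilon>..<0}. \<phi> x t \<in> interior N) \<and>
     (\<forall>x\<in>frontier N - No. \<exists>\<delta>>0. \<forall>t\<in>{0<..\<delta>}. \<phi> x t \<in> interior N)"

definition saddle :: "('a::metric_space \<Rightarrow> real \<Rightarrow> 'a) \<Rightarrow> 'a set \<Rightarrow> bool" where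
  "saddle \<phi> K \<longleftrightarrow>
     compact K \<and> invariant \<phi> K \<and>
     (\<exists>U. neighborhood K U \<and>
        (\<forall>V. neighborhood K V \<longrightarrow>
           (\<exists>x\<in>V. \<not> forward_orbit \<phi> x \<subseteq> U \<and> \<not> backward_orbit \<phi> x \<subseteq> U)))"

definition non_saddle :: "('a::metric_space \<Rightarrow> real \<Rightarrow> 'a) \<Rightarrow> 'a set \<Rightarrow> bool" where
  "non_saddle \<phi> K \<longleftrightarrow> compact K \<and> invariant \<phi> K \<and> \<not> saddle \<phi> K"

text \<open>Asymptotic stability is Lyapunov stability together with attraction of all points of some
  neighborhood.\<close>

definition attractor :: "('a::metric_space \<Rightarrow> real \<Rightarrow> 'a) \<Rightarrow> 'a set \<Rightarrow> bool" where
  "attractor \<phi> K \<longleftrightarrow>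
     compact K \<and> invariant \<phi> K \<and>
     (\<forall>U. neighborhood K U \<longrightarrow>
        (\<exists>V. neighborhood K V \<and> (\<forall>x\<in>V. forward_orbit \<phi> x \<subseteq> U))) \<and>
     (\<exists>U. neighborhood K U \<and>
        (\<forall>x\<in>U. \<forall>V. neighborhood K V \<longrightarrow> (\<forall>\<^sub>F t in at_top. \<phi> x t \<in> V)))"

definition repeller :: "('a::metric_space \<Rightarrow> real \<Rightarrow> 'a) \<Rightarrow> 'a set \<Rightarrow> bool" where
  "repeller \<phi> K \<longleftrightarrow> attractor (reverse_flow \<phi>) K"


section \<open>Collapsing a subspace to a point\<close>

text \<open>\<open>collapse X A\<close> is the quotient \<open>X/A\<close> with base point \<open>None\<close>; for \<open>A = {}\<close> this is \<open>X\<close> with a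
  disjoint isolated base point, as usual in Conley index theory.\<close>

definition collapse_map :: "'a set \<Rightarrow> 'a \<Rightarrow> 'a option" where
  "collapse_map A x = (if x \<in> A then None else Some x)"

definition collapse :: "'a topology \<Rightarrow> 'a set \<Rightarrow> 'a option topology" where
  "collapse X A = topology (\<lambda>V.
     V \<subseteq> insert None (Some ` (topspace X - A)) \<and>
     openin X {x \<in> topspace X. collapse_map A x \<in> V})"

lemma openin_collapse:
  "openin (collapse X A) V \<longleftrightarrow>
     V \<subseteq> insert None (Some ` (topspace X - A)) \<and>
     openin X {x \<in> topspace X. collapse_map A x \<in> V}"
proof -
  have "istopology (\<lambda>V. V \<subseteq> insert None (Some ` (topspace X - A)) \<and>
          openin X {x \<in> topspace X. collapse_map A x \<in> V})" (is "istopology ?P")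
    unfolding istopology_def
  proof (intro conjI allI impI)
    fix S T assume "?P S" "?P T"
    moreover have "{x \<in> topspace X. collapse_map A x \<in> S \<inter> T} =
        {x \<in> topspace X. collapse_map A x \<in> S} \<inter> {x \<in> topspace X. collapse_map A x \<in> T}"
      by auto
    ultimately show "S \<inter> T \<subseteq> insert None (Some ` (topspace X - A))"
      and "openin X {x \<in> topspace X. collapse_map A x \<in> S \<inter> T}"
      by (auto simp: openin_Int)
  next
    fix \<K> assume K: "\<forall>S\<in>\<K>. ?P S"
    then show "\<Union>\<K> \<subseteq> insert None (Some ` (topspace X - A))" by blast
    have "{x \<in> topspace X. collapse_map A x \<in> \<Union>\<K>} =
        (\<Union>S\<in>\<K>. {x \<in> topspace X. collapse_map A x \<in> S})"
      by auto
    moreover have "openin X (\<Union>S\<in>\<K>. {x \<in> topspace X. collapse_map A x \<in> S})"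
      using K by blast
    ultimately show "openin X {x \<in> topspace X. collapse_map A x \<in> \<Union>\<K>}"
      by simp
  qed
  then show ?thesis
    by (simp add: collapse_def topology_inverse')
qed

lemma topspace_collapse: "topspace (collapse X A) = insert None (Some ` (topspace X - A))"
proof -
  have "{x \<in> topspace X. collapse_map A x \<in> insert None (Some ` (topspace X - A))} = topspace X"
    by (auto simp: collapse_map_def)
  then have "openin (collapse X A) (insert None (Some ` (topspace X - A)))"
    by (simp add: openin_collapse)
  then show ?thesis
    by (metis openin_collapse openin_subset openin_topspace subset_antisym)
qed

lemma quotient_map_collapse:
  assumes "A \<inter> topspace X \<noteq> {}"
  shows "quotient_map X (collapse X A) (collapse_map A)"
  using assms
  by (fastforce simp: quotient_map_def topspace_collapse openin_collapse collapse_map_def)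


section \<open>Cech cohomology of a pair, with integer coefficients\<close>

text \<open>
  An open covering of the pair \<open>(X, A)\<close> is a pair \<open>(\<U>, \<A>)\<close> where \<open>\<U>\<close> is an open covering of \<open>X\<close> and
  \<open>\<A> \<subseteq> \<U>\<close> covers \<open>A\<close>.  The group of the covering is the cohomology of the nerve of \<open>\<U>\<close> relative
  to the subcomplex of the simplices spanned by \<open>\<A>\<close> whose members have a common point in \<open>A\<close>.  It is
  computed from ordered cochains, the simplices being lists of vertices, possibly with repetitions.
  Cech cohomology is the direct limit of these groups over all open coverings of \<open>(X, A)\<close>.
\<close>

type_synonym 'a covering = "'a set set \<times> 'a set set"
type_synonym 'a cech_cochain = "'a set list \<Rightarrow> int"

definition open_coverings :: "'a topology \<Rightarrow> 'a set \<Rightarrow> 'a covering set" where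
  "open_coverings X A =
     {(\<U>, \<A>). (\<forall>U\<in>\<U>. openin X U) \<and> \<Union>\<U> = topspace X \<and> \<A> \<subseteq> \<U> \<and> A \<subseteq> \<Union>\<A>}"

definition nerve_simplices :: "nat \<Rightarrow> 'a set set \<Rightarrow> 'a set \<Rightarrow> 'a set list set" where
  "nerve_simplices n \<U> S = {\<sigma>. length \<sigma> = Suc n \<and> set \<sigma> \<subseteq> \<U> \<and> S \<inter> \<Inter>(set \<sigma>) \<noteq> {}}"

text \<open>Relative cochains are extended by zero to all lists.\<close>

definition cech_cochains ::
    "nat \<Rightarrow> 'a topology \<Rightarrow> 'a set \<Rightarrow> 'a covering \<Rightarrow> 'a cech_cochain set" where
  "cech_cochains n X A = (\<lambda>(\<U>, \<A>).
     {c. \<forall>\<sigma>. \<sigma> \<notin> nerve_simplices n \<U> (topspace X) - nerve_simplices n \<A> A \<longrightarrow> c \<sigma> = 0})"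

definition cech_coboundary :: "'a cech_cochain \<Rightarrow> 'a cech_cochain" where
  "cech_coboundary c \<sigma> = (\<Sum>i<length \<sigma>. (-1) ^ i * c (take i \<sigma> @ drop (Suc i) \<sigma>))"

definition cech_cocycles ::
    "nat \<Rightarrow> 'a topology \<Rightarrow> 'a set \<Rightarrow> 'a covering \<Rightarrow> 'a cech_cochain set" where
  "cech_cocycles n X A \<UU> =
     {c \<in> cech_cochains n X A \<UU>.
        \<forall>\<sigma>\<in>nerve_simplices (Suc n) (fst \<UU>) (topspace X). cech_coboundary c \<sigma> = 0}"

definition cech_coboundaries ::
    "nat \<Rightarrow> 'a topology \<Rightarrow> 'a set \<Rightarrow> 'a covering \<Rightarrow> 'a cech_cochain set" where
  "cech_coboundaries n X A \<UU> = (case n of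
       0 \<Rightarrow> {\<lambda>\<sigma>. 0}
     | Suc m \<Rightarrow>
         {c \<in> cech_cochains n X A \<UU>.
            \<exists>b\<in>cech_cochains m X A \<UU>.
              \<forall>\<sigma>\<in>nerve_simplices n (fst \<UU>) (topspace X). c \<sigma> = cech_coboundary b \<sigma>})"

definition refinement_projection ::
    "'a covering \<Rightarrow> 'a covering \<Rightarrow> ('a set \<Rightarrow> 'a set) \<Rightarrow> bool" where
  "refinement_projection \<WW> \<UU> p \<longleftrightarrow>
     (\<forall>W\<in>fst \<WW>. p W \<in> fst \<UU> \<and> W \<subseteq> p W) \<and> (\<forall>W\<in>snd \<WW>. p W \<in> snd \<UU>)"

definition cech_pullback ::
    "nat \<Rightarrow> 'a topology \<Rightarrow> 'a covering \<Rightarrow> ('a set \<Rightarrow> 'a set) \<Rightarrow> 'a cech_cochain \<Rightarrow> 'a cech_cochain"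
  where
  "cech_pullback n X \<WW> p c \<sigma> =
     (if \<sigma> \<in> nerve_simplices n (fst \<WW>) (topspace X) then c (map p \<sigma>) else 0)"

text \<open>An element of the direct limit is an equivalence class of pairs consisting of a covering and a
  cocycle; two pairs are equivalent if the cocycles become cohomologous on a common refinement.\<close>

definition cech_pairs ::
    "nat \<Rightarrow> 'a topology \<Rightarrow> 'a set \<Rightarrow> ('a covering \<times> 'a cech_cochain) set" where
  "cech_pairs n X A = (SIGMA \<UU> : open_coverings X A. cech_cocycles n X A \<UU>)"

definition cech_rel ::
    "nat \<Rightarrow> 'a topology \<Rightarrow> 'a set \<Rightarrow> ('a covering \<times> 'a cech_cochain) rel" where
  "cech_rel n X A =
     {((\<UU>, c), (\<VV>, d)). (\<UU>, c) \<in> cech_pairs n X A \<and> (\<VV>, d) \<in> cech_pairs n X A \<and>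
        (\<exists>\<WW> p q. \<WW> \<in> open_coverings X A \<and>
           refinement_projection \<WW> \<UU> p \<and> refinement_projection \<WW> \<VV> q \<and>
           (\<lambda>\<sigma>. cech_pullback n X \<WW> p c \<sigma> - cech_pullback n X \<WW> q d \<sigma>)
             \<in> cech_coboundaries n X A \<WW>)}"

text \<open>Classes are added by representing them on the same covering.\<close>

definition cech_cohomology_group ::
    "nat \<Rightarrow> 'a topology \<Rightarrow> 'a set \<Rightarrow> ('a covering \<times> 'a cech_cochain) set monoid" where
  "cech_cohomology_group n X A =
     \<lparr>carrier = cech_pairs n X A // cech_rel n X A,
      monoid.mult = (\<lambda>P Q. cech_rel n X A ``
        {(\<WW>, \<lambda>\<sigma>. c \<sigma> + d \<sigma>) | \<WW> c d. (\<WW>, c) \<in> P \<and> (\<WW>, d) \<in> Q}),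
      one = cech_rel n X A `` (open_coverings X A \<times> {\<lambda>\<sigma>. 0})\<rparr>"


section \<open>Cohomological Conley indices\<close>

text \<open>For an isolating block \<open>N\<close> of \<open>K\<close>, the pointed spaces \<open>N/N\<^sup>o\<close> and \<open>N/N\<^sup>i\<close> represent the
  Conley index and the negative Conley index of \<open>K\<close>.  Their pointed homotopy types, and hence the
  groups below up to isomorphism, do not depend on the block, so it is immaterial which isolating
  block is used to decide that an index group of \<open>K\<close> is trivial.\<close>

definition block_index_group ::
    "nat \<Rightarrow> 'a::metric_space set \<Rightarrow> 'a set \<Rightarrow> ('a option covering \<times> 'a option cech_cochain) set monoid"
  where
  "block_index_group n N L = cech_cohomology_group n (collapse (top_of_set N) L) {None}"

definition trivial_CH_plus ::
    "nat \<Rightarrow> ('a::metric_space \<Rightarrow> real \<Rightarrow> 'a) \<Rightarrow> 'a set \<Rightarrow> bool" where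
  "trivial_CH_plus n \<phi> K \<longleftrightarrow>
     (\<exists>N Ni No. isolating_block \<phi> K N Ni No \<and> trivial_group (block_index_group n N No))"

definition trivial_CH_minus ::
    "nat \<Rightarrow> ('a::metric_space \<Rightarrow> real \<Rightarrow> 'a) \<Rightarrow> 'a set \<Rightarrow> bool" where
  "trivial_CH_minus n \<phi> K \<longleftrightarrow>
     (\<exists>N Ni No. isolating_block \<phi> K N Ni No \<and> trivial_group (block_index_group n N Ni))"


section \<open>Singular cohomology with integer coefficients\<close>

definition singular_cochain_group ::
    "nat \<Rightarrow> 'a topology \<Rightarrow> ('a chain \<Rightarrow> int) monoid" where
  "singular_cochain_group p X =
     \<lparr>carrier = hom (chain_group p X) integer_group \<inter> extensional (singular_chain_set p X),
      monoid.mult = (\<lambda>c d. restrict (\<lambda>a. c a + d a) (singular_chain_set p X)),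
      one = restrict (\<lambda>a. 0) (singular_chain_set p X)\<rparr>"

definition singular_coboundary_map ::
    "nat \<Rightarrow> 'a topology \<Rightarrow> ('a chain \<Rightarrow> int) \<Rightarrow> 'a chain \<Rightarrow> int" where
  "singular_coboundary_map p X c =
     restrict (\<lambda>a. c (chain_boundary (Suc p) a)) (singular_chain_set (Suc p) X)"

definition singular_cocycles :: "nat \<Rightarrow> 'a topology \<Rightarrow> ('a chain \<Rightarrow> int) set" where
  "singular_cocycles p X =
     {c \<in> carrier (singular_cochain_group p X).
        singular_coboundary_map p X c = \<one>\<^bsub>singular_cochain_group (Suc p) X\<^esub>}"

definition singular_coboundaries :: "nat \<Rightarrow> 'a topology \<Rightarrow> ('a chain \<Rightarrow> int) set" where
  "singular_coboundaries p X = (case p of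
       0 \<Rightarrow> {\<one>\<^bsub>singular_cochain_group 0 X\<^esub>}
     | Suc q \<Rightarrow> singular_coboundary_map q X ` carrier (singular_cochain_group q X))"

definition singular_cohomology_group ::
    "nat \<Rightarrow> 'a topology \<Rightarrow> ('a chain \<Rightarrow> int) set monoid" where
  "singular_cohomology_group p X =
     (singular_cochain_group p X \<lparr>carrier := singular_cocycles p X\<rparr>) Mod singular_coboundaries p X"


section \<open>Topological manifolds without boundary\<close>

definition topological_manifold :: "nat \<Rightarrow> 'a topology \<Rightarrow> bool" where
  "topological_manifold n X \<longleftrightarrow>
     Hausdorff_space X \<and>
     (\<exists>\<B>. countable \<B> \<and> (\<forall>B\<in>\<B>. openin X B) \<and>
        (\<forall>U x. openin X U \<and> x \<in> U \<longrightarrow> (\<exists>B\<in>\<B>. x \<in> B \<and> B \<subseteq> U))) \<and>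
     (\<forall>x\<in>topspace X. \<exists>U V. openin X U \<and> x \<in> U \<and> openin (Euclidean_space n) V \<and>
        subtopology X U homeomorphic_space subtopology (Euclidean_space n) V)"

end

theory Submission
  imports Defs
begin

text \<open>
  Near \<open>K\<close>, the space minus \<open>K\<close> splits into two open sides \<open>P\<close> and \<open>P'\<close>, both accumulating at \<open>K\<close>
  (\<open>two_components_give_two_sides\<close>).  Orbits outside \<open>K\<close> do not change sides while they are near \<open>K\<close>.
  By compactness, each side contains a point whose past stays near \<open>K\<close> (an unstable point) or a point
  whose future does (a stable point); see \<open>stable_or_unstable_point_on_side\<close>.

  The triviality of \<open>CH\<^sub>+\<^sup>1\<close> forbids unstable points on both sides, and that of \<open>CH\<^sub>-\<^sup>1\<close> forbids stable
  points on both sides (\<open>unstable_points_on_one_side\<close>).  The classical reason is that \<open>CH\<^sub>+\<^sup>1\<close> is the first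
  cohomology of the unstable manifold of \<open>K\<close> in a block relative to its exit points.  This unstable
  manifold is connected, since every past orbit in it accumulates at the connected \<open>K\<close>; so the vanishing of the
  relative group makes the exit points connected, and they cannot be distributed over two sides.  Here
  the argument is made explicit by one circle-valued map on \<open>N/N\<^sup>o\<close>: a trivial first Cech cohomology
  allows it to be lifted to the reals (\<open>circle_map_lift_if_block_index_trivial\<close>), and the lift gives a
  contradiction.

  Consequently one side is unstable without stable points, and the other one is stable without unstable
  points.  The first excludes that \<open>K\<close> is an attractor, the second that it is a repeller.  If \<open>K\<close> were
  saddle, points close to \<open>K\<close> leaving a fixed neighborhood in both time directions would yield unstable
  and stable points on the same side (\<open>unstable_point_on_side\<close> for the flow and its reverse).

  The first singular cohomology is detected by a loop: one that crosses \<open>K\<close> once, from one side to the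
  other, and returns in the connected complement of \<open>K\<close>.  A map to the circle that turns once
  across \<open>K\<close> turns once along this loop; the turning of this map along singular simplices gives an integer cocycle that is not
  a coboundary (\<open>H1_nontrivial_if_two_sided_nonseparating\<close>).
\<close>

section \<open>Lifting circle-valued maps to the real line\<close>

lemma cis_eq_iff_int: "cis x = cis y \<longleftrightarrow> (\<exists>n::int. x = y + 2 * pi * of_int n)"
  using sin_cos_eq_iff[of x y] by (auto simp: complex_eq_iff)

text \<open>The lifts of the constant map \<open>1\<close> take values in the discrete set \<open>2 \<pi> \<int>\<close>.  Applied to a difference
  of two lifts, this is the uniqueness of lifts on connected sets.\<close>

lemma integer_lift_constant:
  fixes w :: "'a::topological_space \<Rightarrow> real"
  assumes "connected A" "continuous_on A w" "\<And>x. x \<in> A \<Longrightarrow> cis (w x) = 1" "x \<in> A" "y \<in> A"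
  shows "w x = w y"
proof -
  have "w constant_on A"
  proof (rule continuous_discrete_range_constant[OF assms(1,2)])
    fix x assume x: "x \<in> A"
    show "\<exists>e>0. \<forall>y. y \<in> A \<and> w y \<noteq> w x \<longrightarrow> e \<le> norm (w y - w x)"
    proof (intro exI[of _ "2 * pi"] conjI allI impI)
      fix y assume y: "y \<in> A \<and> w y \<noteq> w x"
      then have "cis (w y) = cis (w x)" using assms(3) x by simp
      then obtain n :: int where n: "w y = w x + 2 * pi * n" by (auto simp: cis_eq_iff_int)
      then have "n \<noteq> 0" using y by auto
      then have "\<bar>real_of_int n\<bar> \<ge> 1" by linarith
      then show "2 * pi \<le> norm (w y - w x)" using n by (simp add: abs_mult)
    qed simp
  qed
  then show ?thesis using assms(4,5) by (metis constant_on_def)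
qed

text \<open>Where \<open>u y / u x\<close> has positive real part, its principal argument is continuous and lies strictly
  between \<open>-\<pi>/2\<close> and \<open>\<pi>/2\<close>; this bounds the oscillation of the lift by \<open>\<pi>\<close>.\<close>

lemma circle_map_local_lift:
  assumes u: "continuous_map X euclidean u" and u1: "\<And>x. x \<in> topspace X \<Longrightarrow> norm (u x) = 1"
    and x: "x \<in> topspace X"
  obtains U l where "openin X U" "x \<in> U" "continuous_map (subtopology X U) euclideanreal l"
    "\<And>y. y \<in> U \<Longrightarrow> u y = cis (l y)" "\<And>y z. y \<in> U \<Longrightarrow> z \<in> U \<Longrightarrow> \<bar>l y - l z\<bar> < pi"
proof -
  define v where "v y = u y / u x" for y
  define U where "U = {y \<in> topspace X. v y \<in> {z. Re z > 0}}"
  define l where "l y = Arg (u x) + Im (Ln (v y))" for y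
  have ux: "u x \<noteq> 0" using u1[OF x] by auto
  have v: "continuous_map X euclidean v"
    unfolding v_def using continuous_map_compose[OF u, of euclidean "\<lambda>z. z / u x"] ux
    by (simp add: o_def continuous_intros)
  have nv: "norm (v y) = 1" if "y \<in> topspace X" for y
    using u1 x that by (simp add: v_def norm_divide)
  have UX: "U \<subseteq> topspace X" by (auto simp: U_def)
  show ?thesis
  proof
    show "openin X U"
      unfolding U_def by (rule openin_continuous_map_preimage[OF v]) (simp add: open_halfspace_Re_gt)
    show "x \<in> U" using x ux by (simp add: U_def v_def)
    have "continuous_on {z. Re z > 0} (\<lambda>z. Im (Ln z))"
      by (intro continuous_intros) (auto simp: complex_nonpos_Reals_iff)
    moreover have "continuous_map (subtopology X U) (top_of_set {z. Re z > 0}) v"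
      using v by (auto simp: continuous_map_in_subtopology continuous_map_from_subtopology U_def)
    ultimately have "continuous_map (subtopology X U) euclideanreal ((\<lambda>z. Im (Ln z)) \<circ> v)"
      by (intro continuous_map_compose) auto
    then show "continuous_map (subtopology X U) euclideanreal l"
      unfolding l_def o_def by (intro continuous_intros) auto
    show "u y = cis (l y)" if "y \<in> U" for y
    proof -
      have v0: "v y \<noteq> 0" "norm (v y) = 1" using nv UX that by force+
      have "cis (l y) = cis (Arg (u x)) * cis (Arg (v y))"
        using v0 by (simp add: l_def cis_mult Arg_eq_Im_Ln)
      also have "\<dots> = u x * v y"
        using ux v0 u1[OF x] by (simp add: cis_Arg sgn_div_norm)
      finally show ?thesis using ux by (simp add: v_def)
    qed
    show "\<bar>l y - l z\<bar> < pi" if "y \<in> U" "z \<in> U" for y z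
    proof -
      have "\<bar>Im (Ln (v y))\<bar> < pi/2" "\<bar>Im (Ln (v z))\<bar> < pi/2"
        using that Re_Ln_pos_lt_imp unfolding U_def by blast+
      then show ?thesis by (simp add: l_def)
    qed
  qed
qed

lemma circle_map_lift_on_convex:
  fixes v :: "'a::real_normed_vector \<Rightarrow> complex"
  assumes "convex S" "continuous_on S v" "\<And>x. x \<in> S \<Longrightarrow> norm (v x) = 1"
  obtains g where "continuous_on S g" "\<And>x. x \<in> S \<Longrightarrow> v x = cis (g x)"
proof -
  obtain h where h: "continuous_on S h" "\<And>x. x \<in> S \<Longrightarrow> v x = exp (h x)"
    using continuous_logarithm_on_contractible[OF assms(2) convex_imp_contractible[OF assms(1)]] assms(3)
    by (metis norm_zero zero_neq_one)
  show ?thesis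
  proof
    show "continuous_on S (\<lambda>x. Im (h x))" using h(1) by (intro continuous_intros)
    show "v x = cis (Im (h x))" if "x \<in> S" for x
    proof -
      have "exp (Re (h x)) = 1" using h(2)[OF that] assms(3)[OF that] by simp
      then show ?thesis using h(2)[OF that] by (simp add: exp_eq_polar)
    qed
  qed
qed

section \<open>Circle-valued maps and first Cech cohomology\<close>

text \<open>The zero class consists of the pairs equivalent to a zero cocycle on some covering; so a cocycle
  whose class vanishes becomes a coboundary after refinement.\<close>

lemma trivial_cech_cocycle_is_coboundary:
  assumes triv: "trivial_group (cech_cohomology_group (Suc m) X A)"
    and c: "(\<UU>, c) \<in> cech_pairs (Suc m) X A"
  obtains \<WW> p b where "\<WW> \<in> open_coverings X A" "refinement_projection \<WW> \<UU> p"
    "b \<in> cech_cochains m X A \<WW>"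
    "\<And>\<sigma>. \<sigma> \<in> nerve_simplices (Suc m) (fst \<WW>) (topspace X) \<Longrightarrow> c (map p \<sigma>) = cech_coboundary b \<sigma>"
proof -
  let ?R = "cech_rel (Suc m) X A"
  have "\<UU> \<in> open_coverings X A"
    using c by (auto simp: cech_pairs_def)
  moreover have "refinement_projection \<UU> \<UU> id"
    by (auto simp: refinement_projection_def)
  moreover have "(\<lambda>\<sigma>. cech_pullback (Suc m) X \<UU> id c \<sigma> - cech_pullback (Suc m) X \<UU> id c \<sigma>)
      \<in> cech_coboundaries (Suc m) X A \<UU>"
    by (auto simp: cech_coboundaries_def cech_cochains_def cech_coboundary_def split: prod.splits
        intro!: bexI[of _ "\<lambda>_. 0"])
  ultimately have refl: "((\<UU>, c), (\<UU>, c)) \<in> ?R"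
    using c unfolding cech_rel_def by blast
  have "?R `` {(\<UU>, c)} \<in> carrier (cech_cohomology_group (Suc m) X A)"
    using c by (auto simp: cech_cohomology_group_def quotient_def)
  then have "?R `` {(\<UU>, c)} = ?R `` (open_coverings X A \<times> {\<lambda>\<sigma>. 0})"
    using triv by (auto simp: trivial_group_def cech_cohomology_group_def)
  then obtain \<VV> where "((\<VV>, \<lambda>\<sigma>. 0), (\<UU>, c)) \<in> ?R"
    using refl by blast
  then obtain \<WW> p q where W: "\<WW> \<in> open_coverings X A" "refinement_projection \<WW> \<UU> q"
    and "(\<lambda>\<sigma>. cech_pullback (Suc m) X \<WW> p (\<lambda>_. 0) \<sigma> - cech_pullback (Suc m) X \<WW> q c \<sigma>)
            \<in> cech_coboundaries (Suc m) X A \<WW>"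
    unfolding cech_rel_def by blast
  then obtain b where b: "b \<in> cech_cochains m X A \<WW>" and
    eq: "\<forall>\<sigma>\<in>nerve_simplices (Suc m) (fst \<WW>) (topspace X).
        cech_pullback (Suc m) X \<WW> p (\<lambda>_. 0) \<sigma> - cech_pullback (Suc m) X \<WW> q c \<sigma> = cech_coboundary b \<sigma>"
    by (auto simp: cech_coboundaries_def)
  show ?thesis
  proof
    show "(\<lambda>\<sigma>. - b \<sigma>) \<in> cech_cochains m X A \<WW>"
      using b by (auto simp: cech_cochains_def)
    fix \<sigma> assume s: "\<sigma> \<in> nerve_simplices (Suc m) (fst \<WW>) (topspace X)"
    have "cech_coboundary (\<lambda>\<sigma>. - b \<sigma>) \<sigma> = - cech_coboundary b \<sigma>"
      by (simp add: cech_coboundary_def sum_negf)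
    then show "c (map q \<sigma>) = cech_coboundary (\<lambda>\<sigma>. - b \<sigma>) \<sigma>"
      using eq s by (fastforce simp: cech_pullback_def)
  qed (use W in auto)
qed

text \<open>A circle-valued map represents a class in the first Cech cohomology, and it lifts to the reals if
  this class vanishes.  The covering consists of all open sets that carry a lift of small oscillation;
  on an overlap the chosen lifts differ by an integer multiple of \<open>2 \<pi>\<close>, and these integers form a
  cocycle.  A cochain bounding it on a refinement corrects the local lifts to a global one.  Since the
  lifts are normalised at the base point, the cocycle is a relative one.\<close>

lemma circle_map_lift_if_cech_1_trivial:
  assumes triv: "trivial_group (cech_cohomology_group 1 X {a})" and a: "a \<in> topspace X"
    and u: "continuous_map X euclidean u" and u1: "\<And>x. x \<in> topspace X \<Longrightarrow> norm (u x) = 1"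
    and ua: "u a = 1"
  obtains g where "continuous_map X euclideanreal g" "g a = 0" "\<And>x. x \<in> topspace X \<Longrightarrow> u x = cis (g x)"
proof -
  \<comment> \<open>A lift over \<open>U\<close> that varies by less than \<open>\<pi>\<close>: two such lifts differ by a multiple of \<open>2\<pi>\<close>
    that varies by less than \<open>2\<pi>\<close>, hence is constant even where \<open>U \<inter> V\<close> is disconnected.\<close>
  define lift where "lift U l \<longleftrightarrow> continuous_map (subtopology X U) euclideanreal l \<and>
      (\<forall>y\<in>U. u y = cis (l y)) \<and> (\<forall>y\<in>U. \<forall>z\<in>U. \<bar>l y - l z\<bar> < pi) \<and> (a \<in> U \<longrightarrow> l a = 0)" for U l
  define \<U> where "\<U> = {U. openin X U \<and> (\<exists>l. lift U l)}"
  define l where "l U = (SOME l. lift U l)" for U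
  have l: "lift U (l U)" if "U \<in> \<U>" for U
    using that someI_ex[of "lift U"] by (auto simp: \<U>_def l_def)
  have lcont: "continuous_map (subtopology X U) euclideanreal (l U)"
    and lu: "\<And>y. y \<in> U \<Longrightarrow> u y = cis (l U y)"
    and lsmall: "\<And>y z. y \<in> U \<Longrightarrow> z \<in> U \<Longrightarrow> \<bar>l U y - l U z\<bar> < pi"
    and la: "a \<in> U \<Longrightarrow> l U a = 0" if "U \<in> \<U>" for U
    using l[OF that] by (auto simp: lift_def)
  have US: "U \<subseteq> topspace X" if "U \<in> \<U>" for U
    using that openin_subset by (auto simp: \<U>_def)
  have cover: "\<exists>U\<in>\<U>. x \<in> U" if x: "x \<in> topspace X" for x
  proof -
    obtain U k where U: "openin X U" "x \<in> U" and k: "continuous_map (subtopology X U) euclideanreal k"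
      "\<And>y. y \<in> U \<Longrightarrow> u y = cis (k y)" "\<And>y z. y \<in> U \<Longrightarrow> z \<in> U \<Longrightarrow> \<bar>k y - k z\<bar> < pi"
      using circle_map_local_lift[OF u u1 x] by blast
    \<comment> \<open>Shifting by \<open>d\<close>, a multiple of \<open>2\<pi>\<close>, makes the lift vanish at the base point.\<close>
    define d where "d = (if a \<in> U then k a else 0)"
    have "cis d = 1" using k(2)[of a] ua by (auto simp: d_def)
    then have "lift U (\<lambda>y. k y - d)"
      using k by (auto simp: lift_def d_def cis_divide[symmetric] intro!: continuous_intros)
    then show ?thesis using U by (auto simp: \<U>_def)
  qed
  define c0 where "c0 U V x = \<lfloor>(l V x - l U x) / (2*pi)\<rfloor>" for U V x
  have c0: "l V x - l U x = 2 * pi * of_int (c0 U V x)" if "U \<in> \<U>" "V \<in> \<U>" "x \<in> U \<inter> V" for U V x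
  proof -
    have "cis (l V x) = cis (l U x)" using lu[of U x] lu[of V x] that by auto
    then show ?thesis by (auto simp: cis_eq_iff_int c0_def)
  qed
  have c0_const: "c0 U V x = c0 U V y" if UV: "U \<in> \<U>" "V \<in> \<U>" "x \<in> U \<inter> V" "y \<in> U \<inter> V" for U V x y
  proof -
    have "\<bar>(l V x - l U x) - (l V y - l U y)\<bar> < 2 * pi"
      using lsmall[of U x y] lsmall[of V x y] UV by auto
    then have "2 * pi * \<bar>of_int (c0 U V x - c0 U V y)\<bar> < 2 * pi * (1::real)"
      using c0[of U V x] c0[of U V y] UV by (simp add: abs_mult flip: right_diff_distrib)
    then have "\<bar>of_int (c0 U V x - c0 U V y)\<bar> < (1::real)" by simp
    then show ?thesis by linarith
  qed
  define c where "c \<sigma> = (if \<sigma> \<in> nerve_simplices 1 \<U> (topspace X)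
      then c0 (\<sigma>!0) (\<sigma>!1) (SOME x. x \<in> \<sigma>!0 \<inter> \<sigma>!1) else 0)" for \<sigma>
  have nerve1: "[U,V] \<in> nerve_simplices 1 \<U> (topspace X)" if "U \<in> \<U>" "V \<in> \<U>" "x \<in> U \<inter> V" for U V x
    using that US by (auto simp: nerve_simplices_def)
  have c: "c [U,V] = c0 U V x" if UV: "U \<in> \<U>" "V \<in> \<U>" "x \<in> U \<inter> V" for U V x
  proof -
    have "(SOME x. x \<in> U \<inter> V) \<in> U \<inter> V" using UV(3) by (rule someI)
    then have "c0 U V (SOME x. x \<in> U \<inter> V) = c0 U V x"
      by (rule c0_const[OF UV(1,2) _ UV(3)])
    then show ?thesis using nerve1[OF UV] by (simp add: c_def)
  qed
  define \<A> where "\<A> = {U \<in> \<U>. a \<in> U}"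
  have cov: "(\<U>, \<A>) \<in> open_coverings X {a}"
    using cover US a by (auto simp: open_coverings_def \<A>_def) (auto simp: \<U>_def)
  have "c \<in> cech_cocycles 1 X {a} (\<U>, \<A>)"
    unfolding cech_cocycles_def
  proof (intro CollectI conjI ballI)
    show "c \<in> cech_cochains 1 X {a} (\<U>, \<A>)"
      unfolding cech_cochains_def
    proof clarsimp
      fix \<sigma> assume s: "\<sigma> \<in> nerve_simplices (Suc 0) \<U> (topspace X) \<longrightarrow> \<sigma> \<in> nerve_simplices (Suc 0) \<A> {a}"
      show "c \<sigma> = 0"
      proof (cases "\<sigma> \<in> nerve_simplices 1 \<U> (topspace X)")
        case True
        then have "\<sigma> \<in> nerve_simplices 1 \<A> {a}" using s by simp
        then obtain U V where "\<sigma> = [U,V]" "U \<in> \<U>" "V \<in> \<U>" "a \<in> U \<inter> V"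
          by (auto simp: nerve_simplices_def length_Suc_conv \<A>_def)
        then show ?thesis using c[of U V a] la by (simp add: c0_def)
      qed (simp add: c_def)
    qed
    fix \<sigma> assume "\<sigma> \<in> nerve_simplices (Suc 1) (fst (\<U>, \<A>)) (topspace X)"
    then have "length \<sigma> = 3" "set \<sigma> \<subseteq> \<U>" "\<exists>x. x \<in> \<Inter>(set \<sigma>)"
      by (auto simp: nerve_simplices_def)
    then obtain U V W x where s: "\<sigma> = [U,V,W]" and UVW: "U \<in> \<U>" "V \<in> \<U>" "W \<in> \<U>" "x \<in> U" "x \<in> V" "x \<in> W"
      by (auto simp: numeral_3_eq_3 length_Suc_conv)
    have "2 * pi * of_int (c0 V W x - c0 U W x + c0 U V x) = (0::real)"
      using c0[of V W x] c0[of U W x] c0[of U V x] UVW by (simp add: algebra_simps)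
    then have "c0 V W x - c0 U W x + c0 U V x = 0"
      using pi_neq_zero by (metis mult_eq_0_iff of_int_eq_0_iff zero_neq_numeral)
    moreover have "cech_coboundary c \<sigma> = c [V,W] - c [U,W] + c [U,V]"
      by (simp add: s cech_coboundary_def numeral_3_eq_3 numeral_2_eq_2)
    ultimately show "cech_coboundary c \<sigma> = 0"
      using c UVW by auto
  qed
  then have "((\<U>, \<A>), c) \<in> cech_pairs (Suc 0) X {a}"
    using cov by (auto simp: cech_pairs_def)
  then obtain \<WW> p b where W: "\<WW> \<in> open_coverings X {a}" and p: "refinement_projection \<WW> (\<U>, \<A>) p"
    and b: "b \<in> cech_cochains 0 X {a} \<WW>"
    and cb: "\<And>\<sigma>. \<sigma> \<in> nerve_simplices (Suc 0) (fst \<WW>) (topspace X) \<Longrightarrow> c (map p \<sigma>) = cech_coboundary b \<sigma>"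
    using trivial_cech_cocycle_is_coboundary triv by (metis One_nat_def)
  obtain \<V> \<B> where WVB: "\<WW> = (\<V>, \<B>)" by (cases \<WW>)
  have V: "\<And>V. V \<in> \<V> \<Longrightarrow> openin X V" "\<Union>\<V> = topspace X" "\<B> \<subseteq> \<V>" "a \<in> \<Union>\<B>"
    using W by (auto simp: open_coverings_def WVB)
  have p: "\<And>V. V \<in> \<V> \<Longrightarrow> p V \<in> \<U> \<and> V \<subseteq> p V" "\<And>V. V \<in> \<B> \<Longrightarrow> a \<in> p V"
    using p by (auto simp: refinement_projection_def WVB \<A>_def)
  \<comment> \<open>The \<open>0\<close>-cochain \<open>b\<close> supplies the corrections under which the local lifts agree.\<close>
  define f where "f V x = l (p V) x - 2 * pi * of_int (b [V])" for V x
  have fcont: "continuous_map (subtopology X V) euclideanreal (f V)" if "V \<in> \<V>" for V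
  proof -
    have "continuous_map (subtopology X V) euclideanreal (l (p V))"
      using continuous_map_from_subtopology_mono[OF lcont] p(1)[OF that] by blast
    then show ?thesis unfolding f_def by (intro continuous_intros) auto
  qed
  have feq: "f V x = f V' x" if "V \<in> \<V>" "V' \<in> \<V>" "x \<in> V" "x \<in> V'" for V V' x
  proof -
    have "[V,V'] \<in> nerve_simplices (Suc 0) (fst \<WW>) (topspace X)"
      using that V(2) by (auto simp: nerve_simplices_def WVB)
    from cb[OF this] have "c [p V, p V'] = b [V'] - b [V]"
      by (simp add: cech_coboundary_def numeral_2_eq_2)
    moreover have "c [p V, p V'] = c0 (p V) (p V') x"
      using that p by (intro c) auto
    moreover have "l (p V') x - l (p V) x = 2 * pi * of_int (c0 (p V) (p V') x)"
      using that p by (intro c0) auto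
    ultimately have "l (p V') x - l (p V) x = 2 * pi * of_int (b [V'] - b [V])"
      by metis
    then show ?thesis by (simp add: f_def algebra_simps)
  qed
  obtain g where g: "continuous_map X euclideanreal g"
    "\<And>V x. V \<in> \<V> \<Longrightarrow> x \<in> topspace X \<inter> V \<Longrightarrow> g x = f V x"
  proof (rule pasting_lemma_exists[of X "\<lambda>V. V" \<V> euclideanreal f])
    show "topspace X \<subseteq> (\<Union>V\<in>\<V>. V)" using V(2) by simp
    show "f V x = f V' x" if "V \<in> \<V>" "V' \<in> \<V>" "x \<in> topspace X \<inter> V \<inter> V'" for V V' x
      using feq that by blast
  qed (use V(1) fcont in auto)
  show ?thesis
  proof
    obtain V where "V \<in> \<B>" "a \<in> V" using V(4) by blast
    moreover from this have "b [V] = 0"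
      using b by (auto simp: cech_cochains_def WVB nerve_simplices_def)
    ultimately show "g a = 0"
      using g(2)[of V a] V(3) p a la by (auto simp: f_def)
    show "u x = cis (g x)" if "x \<in> topspace X" for x
    proof -
      obtain V where "V \<in> \<V>" "x \<in> V" using V(2) \<open>x \<in> topspace X\<close> by blast
      then have "g x = l (p V) x - 2 * pi * of_int (b [V])"
        using g(2) that by (simp add: f_def)
      moreover have "u x = cis (l (p V) x)"
        using p(1) \<open>V \<in> \<V>\<close> \<open>x \<in> V\<close> by (intro lu) auto
      ultimately show ?thesis
        by (metis cis_eq_iff_int diff_add_cancel)
    qed
  qed (fact g)
qed

text \<open>A map on \<open>N\<close> that is \<open>1\<close> on \<open>L\<close> factors through the quotient \<open>N/L\<close>.\<close>

lemma circle_map_lift_if_block_index_trivial: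
  assumes triv: "trivial_group (block_index_group 1 N L)"
    and u: "continuous_on N u" and u1: "\<And>x. x \<in> N \<Longrightarrow> norm (u x) = 1"
    and uL: "\<And>x. x \<in> L \<Longrightarrow> u x = 1"
  obtains g where "continuous_on N g" "\<And>x. x \<in> N \<inter> L \<Longrightarrow> g x = 0" "\<And>x. x \<in> N \<Longrightarrow> u x = cis (g x)"
proof -
  let ?X = "collapse (top_of_set N) L"
  define v where "v y = (case y of None \<Rightarrow> 1 | Some x \<Rightarrow> u x)" for y
  have vu: "v (collapse_map L x) = u x" if "x \<in> N" for x
    using uL by (auto simp: v_def collapse_map_def)
  have "continuous_map ?X euclidean v"
    unfolding continuous_map_def
  proof safe
    fix T :: "complex set" assume T: "openin euclidean T"
    have "openin (top_of_set N) {x \<in> N. u x \<in> T}"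
      using openin_continuous_map_preimage[of "top_of_set N" euclidean u T] u T by simp
    moreover have "{x \<in> N. u x \<in> T} = {x \<in> topspace (top_of_set N). collapse_map L x \<in> {y \<in> topspace ?X. v y \<in> T}}"
    proof (rule Collect_cong)
      show "x \<in> N \<and> u x \<in> T \<longleftrightarrow> x \<in> topspace (top_of_set N) \<and>
          collapse_map L x \<in> {y \<in> topspace ?X. v y \<in> T}" for x
        using vu[of x] by (cases "x \<in> L") (auto simp: topspace_collapse collapse_map_def)
    qed
    ultimately show "openin ?X {y \<in> topspace ?X. v y \<in> T}"
      by (auto simp: openin_collapse topspace_collapse)
  qed auto
  moreover have "norm (v y) = 1" if "y \<in> topspace ?X" for y
    using that u1 by (auto simp: topspace_collapse v_def)
  ultimately obtain g where g: "continuous_map ?X euclideanreal g" "g None = 0"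
      "\<And>x. x \<in> topspace ?X \<Longrightarrow> v x = cis (g x)"
    using circle_map_lift_if_cech_1_trivial[of ?X None v] triv
    by (auto simp: block_index_group_def topspace_collapse v_def)
  have "continuous_map (top_of_set N) ?X (collapse_map L)"
    by (auto simp: continuous_map_def topspace_collapse openin_collapse collapse_map_def)
  then have "continuous_on N (g \<circ> collapse_map L)"
    using continuous_map_compose[OF _ g(1)] by fastforce
  then show ?thesis
  proof (rule that)
    show "(g \<circ> collapse_map L) x = 0" if "x \<in> N \<inter> L" for x
      using that g(2) by (simp add: collapse_map_def)
    show "u x = cis ((g \<circ> collapse_map L) x)" if "x \<in> N" for x
      using g(3)[of "collapse_map L x"] vu[OF that] that
      by (auto simp: topspace_collapse collapse_map_def split: if_splits)
  qed
qed

section \<open>Flows and time reversal\<close>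

lemma flow_zero: "flow \<phi> \<Longrightarrow> \<phi> x 0 = x"
  and flow_add: "flow \<phi> \<Longrightarrow> \<phi> (\<phi> x s) t = \<phi> x (s + t)"
  by (simp_all add: flow_def)

lemma continuous_on_flow:
  assumes "flow \<phi>" "continuous_on S f" "continuous_on S g"
  shows "continuous_on S (\<lambda>z. \<phi> (f z) (g z))"
proof -
  have "continuous_on S ((\<lambda>(x, t). \<phi> x t) \<circ> (\<lambda>z. (f z, g z)))"
    using assms unfolding flow_def
    by (intro continuous_on_compose continuous_on_Pair) (auto intro: continuous_on_subset)
  then show ?thesis by (simp add: o_def)
qed

lemma flow_tendsto:
  assumes "flow \<phi>" "(f \<longlongrightarrow> x) F" "(g \<longlongrightarrow> t) F"
  shows "((\<lambda>z. \<phi> (f z) (g z)) \<longlongrightarrow> \<phi> x t) F"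
proof -
  have "isCont (\<lambda>(x, t). \<phi> x t) (x, t)"
    using assms(1) by (simp add: flow_def continuous_on_eq_continuous_at)
  from isCont_tendsto_compose[OF this tendsto_Pair[OF assms(2,3)]] show ?thesis by simp
qed

lemma invariant_flow_iff:
  assumes "flow \<phi>" "invariant \<phi> K" shows "\<phi> x t \<in> K \<longleftrightarrow> x \<in> K"
proof
  assume "\<phi> x t \<in> K"
  then have "\<phi> (\<phi> x t) (- t) \<in> K" using assms(2) by (auto simp: invariant_def)
  then show "x \<in> K" by (simp add: flow_add[OF assms(1)] flow_zero[OF assms(1)])
qed (use assms(2) in \<open>auto simp: invariant_def\<close>)

lemma forward_orbit_image: "forward_orbit \<phi> x = \<phi> x ` {0..}"
  and backward_orbit_image: "backward_orbit \<phi> x = \<phi> x ` {..0}"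
  by (auto simp: forward_orbit_def backward_orbit_def)

lemma flow_reverse: assumes "flow \<phi>" shows "flow (reverse_flow \<phi>)"
proof -
  have "continuous_on UNIV (\<lambda>z. \<phi> (fst z) (- snd z))"
    by (intro continuous_on_flow[OF assms] continuous_intros)
  then show ?thesis
    using assms by (auto simp: flow_def reverse_flow_def case_prod_unfold add.commute)
qed

lemma reverse_flow_reverse [simp]: "reverse_flow (reverse_flow \<phi>) = \<phi>"
  by (simp add: fun_eq_iff reverse_flow_def)

lemma forward_orbit_reverse [simp]: "forward_orbit (reverse_flow \<phi>) = backward_orbit \<phi>"
proof
  fix x
  have "{..0::real} = uminus ` {0..}" by simp
  then show "forward_orbit (reverse_flow \<phi>) x = backward_orbit \<phi> x"
    by (simp only: forward_orbit_image backward_orbit_image reverse_flow_def[abs_def] image_image)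
qed

lemma backward_orbit_reverse [simp]: "backward_orbit (reverse_flow \<phi>) = forward_orbit \<phi>"
  using forward_orbit_reverse[of "reverse_flow \<phi>"] by simp

lemma invariant_reverse [simp]: "invariant (reverse_flow \<phi>) = invariant \<phi>"
  by (auto simp: fun_eq_iff invariant_def reverse_flow_def) (metis minus_minus)

lemma isolating_neighborhood_reverse [simp]:
  "isolating_neighborhood (reverse_flow \<phi>) = isolating_neighborhood \<phi>"
  by (simp add: fun_eq_iff isolating_neighborhood_def)

lemma isolating_block_reverse:
  assumes "isolating_block \<phi> K N Ni No" shows "isolating_block (reverse_flow \<phi>) K N No Ni"
proof -
  have past: "(\<forall>t\<in>{-e..<0}. P (- t)) \<longleftrightarrow> (\<forall>t\<in>{0<..e}. P t)" for e :: real and P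
  proof -
    have "{-e..<0} = uminus ` {0<..e}" by simp
    then show ?thesis by (simp only: ball_simps minus_minus)
  qed
  have future: "(\<forall>t\<in>{0<..e}. P (- t)) \<longleftrightarrow> (\<forall>t\<in>{-e..<0}. P t)" for e :: real and P
    using past[of e "\<lambda>t. P (- t)"] by simp
  show ?thesis
    using assms unfolding isolating_block_def isolating_neighborhood_reverse reverse_flow_def
      past[where P="\<lambda>t. \<phi> _ t \<notin> N"] past[where P="\<lambda>t. \<phi> _ t \<in> interior N"]
      future[where P="\<lambda>t. \<phi> _ t \<notin> N"] future[where P="\<lambda>t. \<phi> _ t \<in> interior N"]
    by (elim conjE, intro conjI) (assumption | simp add: Un_commute)+
qed

section \<open>Orbits in isolating neighborhoods and blocks\<close>

lemma whole_orbit_in_isolating_neighborhood: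
  assumes "flow \<phi>" "isolating_neighborhood \<phi> K N" "\<And>t. \<phi> x t \<in> N"
  shows "x \<in> K"
proof -
  have "invariant \<phi> (range (\<phi> x))"
    using assms(1) by (auto simp: invariant_def flow_add)
  then have "range (\<phi> x) \<subseteq> K"
    using assms(2,3) by (auto simp: isolating_neighborhood_def)
  then show ?thesis using flow_zero[OF assms(1), of x] by (metis rangeI subsetD)
qed

text \<open>Otherwise points outside \<open>O'\<close> that stay in \<open>N\<close> for longer and longer times would accumulate, by
  compactness, at a point whose whole orbit is in \<open>N\<close>; such a point belongs to \<open>K\<close>.\<close>

lemma long_stay_forces_closeness:
  assumes flow: "flow \<phi>" and iso: "isolating_neighborhood \<phi> K N" and O: "open O'" "K \<subseteq> O'"
  obtains S :: real where "S > 0" "\<And>x. (\<And>t. \<bar>t\<bar> \<le> S \<Longrightarrow> \<phi> x t \<in> N) \<Longrightarrow> x \<in> O'"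
proof (rule ccontr)
  assume "\<not> thesis"
  then have "\<exists>x. (\<forall>t. \<bar>t\<bar> \<le> real (Suc n) \<longrightarrow> \<phi> x t \<in> N) \<and> x \<notin> O'" for n
    using that[of "real (Suc n)"] by fastforce
  then obtain X where X: "\<And>n t. \<bar>t\<bar> \<le> real (Suc n) \<Longrightarrow> \<phi> (X n) t \<in> N" "\<And>n. X n \<notin> O'"
    by metis
  have N: "compact N" using iso by (simp add: isolating_neighborhood_def)
  have "X n \<in> N" for n using X(1)[of 0 n] flow_zero[OF flow] by simp
  then obtain x r where x: "strict_mono r" "((X \<circ> r) \<longlongrightarrow> x) sequentially"
    using N unfolding compact_def by metis
  have "\<phi> x t \<in> N" for t
  proof (rule Lim_in_closed_set[OF compact_imp_closed[OF N]])
    show "((\<lambda>n. \<phi> (X (r n)) t) \<longlongrightarrow> \<phi> x t) sequentially"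
      using flow_tendsto[OF flow x(2)[unfolded o_def] tendsto_const] .
    have "\<phi> (X (r n)) t \<in> N" if "n \<ge> nat \<lceil>\<bar>t\<bar>\<rceil>" for n
    proof (rule X(1))
      have "\<bar>t\<bar> \<le> real n" using that by linarith
      also have "n \<le> r n" using x(1) by (rule seq_suble)
      finally show "\<bar>t\<bar> \<le> real (Suc (r n))" by simp
    qed
    then show "\<forall>\<^sub>F n in sequentially. \<phi> (X (r n)) t \<in> N"
      by (rule eventually_sequentiallyI[of "nat \<lceil>\<bar>t\<bar>\<rceil>"])
  qed simp
  then have "x \<in> O'" using whole_orbit_in_isolating_neighborhood[OF flow iso] O(2) by blast
  moreover have "x \<in> - O'"
    using X(2) O(1) x(2) by (intro Lim_in_closed_set[of "- O'" "X \<circ> r" sequentially]) auto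
  ultimately show False by simp
qed

text \<open>The limit points in the remote past have their whole orbits in \<open>N\<close>.\<close>

lemma backward_orbit_accumulates_at_isolated_set:
  assumes flow: "flow \<phi>" and iso: "isolating_neighborhood \<phi> K N" and x: "backward_orbit \<phi> x \<subseteq> N"
  shows "closure (backward_orbit \<phi> x) \<inter> K \<noteq> {}"
proof -
  have N: "compact N" using iso by (simp add: isolating_neighborhood_def)
  define X where "X n = \<phi> x (- real n)" for n
  have "\<forall>n. X n \<in> N" using x by (auto simp: X_def backward_orbit_image)
  then obtain y r where y: "strict_mono r" "((X \<circ> r) \<longlongrightarrow> y) sequentially"
    using N unfolding compact_def by metis
  have "\<phi> y t \<in> N" for t
  proof (rule Lim_in_closed_set[OF compact_imp_closed[OF N]])
    show "((\<lambda>n. \<phi> (X (r n)) t) \<longlongrightarrow> \<phi> y t) sequentially"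
      using flow_tendsto[OF flow y(2)[unfolded o_def] tendsto_const] .
    have "\<phi> (X (r n)) t \<in> N" if "n \<ge> nat \<lceil>\<bar>t\<bar>\<rceil>" for n
    proof -
      have "\<bar>t\<bar> \<le> real n" using that by linarith
      also have "n \<le> r n" using y(1) by (rule seq_suble)
      finally have "- real (r n) + t \<le> 0" by simp
      then show ?thesis using x by (auto simp: X_def flow_add[OF flow] backward_orbit_image)
    qed
    then show "\<forall>\<^sub>F n in sequentially. \<phi> (X (r n)) t \<in> N"
      by (rule eventually_sequentiallyI[of "nat \<lceil>\<bar>t\<bar>\<rceil>"])
  qed simp
  then have "y \<in> K" using whole_orbit_in_isolating_neighborhood[OF flow iso] by blast
  moreover have "y \<in> closure (backward_orbit \<phi> x)"
    unfolding closure_sequential using y(2)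
    by (intro exI[of _ "X \<circ> r"]) (auto simp: X_def backward_orbit_image)
  ultimately show ?thesis by blast
qed

text \<open>The exit time is the infimum of the times spent outside \<open>N\<close>.  The last clause distinguishes leaving
  from touching the frontier.\<close>

lemma first_exit:
  assumes flow: "flow \<phi>" and N: "closed N" "x \<in> N" and t: "t \<ge> 0" "\<phi> x t \<notin> N"
  obtains s where "0 \<le> s" "s < t" "\<And>r. 0 \<le> r \<Longrightarrow> r \<le> s \<Longrightarrow> \<phi> x r \<in> N" "\<phi> x s \<in> frontier N"
    "\<And>e. e > 0 \<Longrightarrow> \<exists>r. s < r \<and> r < s + e \<and> \<phi> x r \<notin> N"
proof -
  define B where "B = {r. 0 \<le> r \<and> \<phi> x r \<notin> N}"
  define s where "s = Inf B"
  have B: "B \<noteq> {}" "bdd_below B" using t by (auto simp: B_def bdd_below_def)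
  have s0: "0 \<le> s" unfolding s_def by (rule cInf_greatest[OF B(1)]) (auto simp: B_def)
  have cont: "continuous_on UNIV (\<phi> x)"
    by (intro continuous_on_flow[OF flow] continuous_intros)
  have below: "\<phi> x r \<in> N" if "0 \<le> r" "r < s" for r
    using that cInf_lower[OF _ B(2), of r] by (auto simp: B_def s_def)
  have sN: "\<phi> x s \<in> N"
  proof (cases "s = 0")
    case False
    then have "s \<in> closure {0..<s}" using s0 by simp
    then have "\<phi> x s \<in> closure (\<phi> x ` {0..<s})"
      using image_closure_subset[of "{0..<s}" "\<phi> x" "closure (\<phi> x ` {0..<s})"] cont
      by (auto intro: continuous_on_subset closure_subset[THEN subsetD])
    also have "\<dots> \<subseteq> N" using below N(1) by (intro closure_minimal) auto
    finally show ?thesis .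
  qed (use N flow in \<open>simp add: flow_zero\<close>)
  have above: "\<exists>r. s < r \<and> r < s + e \<and> \<phi> x r \<notin> N" if "e > 0" for e
  proof -
    have "Inf B < s + e" using that by (simp add: s_def)
    then obtain r where r: "r \<in> B" "r < s + e" using cInf_lessD[OF B(1)] by blast
    moreover have "s \<le> r" using cInf_lower[OF r(1) B(2)] by (simp add: s_def)
    moreover have "s \<noteq> r" using r sN by (auto simp: B_def)
    ultimately show ?thesis by (force simp: B_def)
  qed
  have "s \<le> t" using cInf_lower[OF _ B(2), of t] t by (auto simp: B_def s_def)
  then have "s < t" using sN t by (cases "s = t") auto
  moreover have "\<phi> x s \<notin> interior N"
  proof
    assume "\<phi> x s \<in> interior N"
    then have "open (\<phi> x -` interior N)" "s \<in> \<phi> x -` interior N"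
      using cont by (auto intro: open_vimage)
    then obtain e where "e > 0" "ball s e \<subseteq> \<phi> x -` interior N"
      by (meson open_contains_ball)
    moreover obtain r where "s < r" "r < s + e" "\<phi> x r \<notin> N" using above[OF \<open>e > 0\<close>] by blast
    moreover have "r \<in> ball s e" using \<open>s < r\<close> \<open>r < s + e\<close> by (simp add: dist_real_def)
    ultimately show False using interior_subset by blast
  qed
  then have "\<phi> x s \<in> frontier N" using sN N(1) by (simp add: frontier_def)
  moreover have "\<phi> x r \<in> N" if "0 \<le> r" "r \<le> s" for r
    using below[of r] sN that by (cases "r = s") auto
  ultimately show ?thesis using that s0 above by blast
qed

text \<open>At a frontier point outside the exit set the orbit enters the interior, so it cannot be outside \<open>N\<close>
  at arbitrarily small later times.\<close>

lemma exit_through_exit_set: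
  assumes flow: "flow \<phi>" and blk: "isolating_block \<phi> K N Ni No"
    and x: "x \<in> N" and t: "t \<ge> 0" "\<phi> x t \<notin> N"
  obtains s where "0 \<le> s" "s < t" "\<And>r. 0 \<le> r \<Longrightarrow> r \<le> s \<Longrightarrow> \<phi> x r \<in> N" "\<phi> x s \<in> No"
proof -
  have "closed N" using blk by (auto simp: isolating_block_def isolating_neighborhood_def compact_imp_closed)
  then obtain s where s: "0 \<le> s" "s < t" "\<And>r. 0 \<le> r \<Longrightarrow> r \<le> s \<Longrightarrow> \<phi> x r \<in> N" "\<phi> x s \<in> frontier N"
    "\<And>e. e > 0 \<Longrightarrow> \<exists>r. s < r \<and> r < s + e \<and> \<phi> x r \<notin> N"
    using first_exit[OF flow _ x t] by blast
  have "\<phi> x s \<in> No"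
  proof (rule ccontr)
    assume "\<phi> x s \<notin> No"
    then obtain d where d: "d > 0" "\<forall>r\<in>{0<..d}. \<phi> (\<phi> x s) r \<in> interior N"
      using blk s(4) unfolding isolating_block_def by blast
    obtain r where r: "s < r" "r < s + d" "\<phi> x r \<notin> N" using s(5)[OF d(1)] by blast
    have "\<phi> (\<phi> x s) (r - s) \<in> interior N" using d r by auto
    then show False using r interior_subset flow_add[OF flow] by fastforce
  qed
  then show ?thesis using that s by blast
qed

lemma ball_of_infdist_less:
  assumes "K \<noteq> {}" "infdist x K < e"
  shows "x \<in> (\<Union>k\<in>K. ball k e)"
  using assms cInf_lessD[of "dist x ` K" e] by (auto simp: infdist_def dist_commute)

lemma isolating_neighborhood_smaller:
  assumes "isolating_neighborhood \<phi> K N" "closed Q" "Q \<subseteq> N" "K \<subseteq> interior Q"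
  shows "isolating_neighborhood \<phi> K Q"
proof -
  have "compact Q" using assms compact_Int_closed[of N Q] by (simp add: isolating_neighborhood_def Int_absorb1)
  then show ?thesis
    using assms by (auto simp: isolating_neighborhood_def neighborhood_def) (meson order_trans subsetD)
qed

lemma small_isolating_neighborhood:
  assumes iso: "isolating_neighborhood \<phi> K N" and K: "compact K" and G: "open G" "K \<subseteq> G"
  obtains Q where "isolating_neighborhood \<phi> K Q" "Q \<subseteq> N \<inter> G"
proof (cases "K = {}")
  case True
  then have "isolating_neighborhood \<phi> K {}"
    using iso by (auto simp: isolating_neighborhood_def neighborhood_def)
  then show ?thesis using that by blast
next
  case False
  obtain e where e: "e > 0" "(\<Union>x\<in>K. ball x e) \<subseteq> interior N \<inter> G"
    using compact_subset_open_imp_ball_epsilon_subset[OF K, of "interior N \<inter> G"] iso G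
    by (auto simp: isolating_neighborhood_def neighborhood_def)
  define Q where "Q = {x. infdist x K \<le> e / 2}"
  have "x \<in> interior N \<inter> G" if x: "x \<in> Q" for x
  proof -
    have "infdist x K < e" using x e by (simp add: Q_def)
    then show ?thesis using ball_of_infdist_less[OF False] e(2) by blast
  qed
  then have sub: "Q \<subseteq> interior N \<inter> G" by blast
  have "closed Q" unfolding Q_def by (intro closed_Collect_le continuous_intros)
  moreover have "K \<subseteq> interior Q"
  proof (rule interior_maximal[THEN order_trans[rotated]])
    show "open {x. infdist x K < e / 2}" by (intro open_Collect_less continuous_intros)
    show "{x. infdist x K < e / 2} \<subseteq> Q" by (auto simp: Q_def)
    show "K \<subseteq> {x. infdist x K < e / 2}" using e by auto
  qed
  ultimately have "isolating_neighborhood \<phi> K Q"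
    using sub interior_subset by (intro isolating_neighborhood_smaller[OF iso]) auto
  then show ?thesis using that sub interior_subset by blast
qed

section \<open>The two sides of an invariant set\<close>

text \<open>What is left, near \<open>K\<close>, of the two components of \<open>W - K\<close>.  Those components need not be open in the
  space, because \<open>W\<close> is an arbitrary neighborhood.\<close>

definition two_sided :: "'a::metric_space set \<Rightarrow> 'a set \<Rightarrow> 'a set \<Rightarrow> bool" where
  "two_sided K P P' \<longleftrightarrow> open P \<and> open P' \<and> open (K \<union> P \<union> P') \<and>
     K \<inter> P = {} \<and> K \<inter> P' = {} \<and> P \<inter> P' = {}"

lemma two_sided_commute: "two_sided K P P' \<Longrightarrow> two_sided K P' P"
  by (auto simp: two_sided_def Un_ac)

lemma connected_stays_on_one_side:
  assumes "two_sided K P P'" "connected A" "A \<subseteq> K \<union> P \<union> P' - K" "x \<in> A" "x \<in> P"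
  shows "A \<subseteq> P"
  using connectedD[OF assms(2), of P P'] assms by (auto simp: two_sided_def)

text \<open>Each of the finitely many components of \<open>W - K\<close> is open in it.  A component whose closure misses \<open>K\<close>
  would be open and closed in the connected set \<open>W\<close>; hence both sides accumulate at \<open>K\<close>.\<close>

lemma two_components_give_two_sides:
  assumes W: "connected W" "neighborhood K W" and K: "closed K" "K \<noteq> {}"
    and card: "card (components (W - K)) = 2"
  obtains P P' where "two_sided K P P'"
    "\<And>V. neighborhood K V \<Longrightarrow> V \<inter> P \<noteq> {}" "\<And>V. neighborhood K V \<Longrightarrow> V \<inter> P' \<noteq> {}"
proof -
  obtain C C' where CC: "components (W - K) = {C, C'}" "C \<noteq> C'"
    using card by (auto simp: card_2_iff)
  have union: "C \<union> C' = W - K" using Union_components[of "W - K"] CC by auto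
  have disj: "C \<inter> C' = {}" using pairwise_disjoint_components[of "W - K"] CC by (auto simp: pairwise_def disjnt_def)
  have openC: "openin (top_of_set (W - K)) C" and openC': "openin (top_of_set (W - K)) C'"
  proof -
    have "closedin (top_of_set (W - K)) C" "closedin (top_of_set (W - K)) C'"
      using closedin_component CC by auto
    moreover have "C = (W - K) - C'" "C' = (W - K) - C" using union disj by auto
    ultimately show "openin (top_of_set (W - K)) C" "openin (top_of_set (W - K)) C'"
      by (metis openin_diff openin_subtopology_self)+
  qed
  have W0: "K \<subseteq> interior W" using W(2) by (simp add: neighborhood_def)
  have op: "open (A \<inter> interior W)" if A: "openin (top_of_set (W - K)) A" for A
  proof -
    obtain T where T: "open T" "A = (W - K) \<inter> T" using A unfolding openin_open by metis
    then have "A \<inter> interior W = T \<inter> (interior W - K)" using interior_subset[of W] by auto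
    then show ?thesis using T K by (simp add: open_Diff open_Int)
  qed
  have accum: "V \<inter> (A \<inter> interior W) \<noteq> {}"
    if V: "neighborhood K V" and A: "A \<in> components (W - K)" "openin (top_of_set (W - K)) A" for A V
  proof -
    have AW: "A \<noteq> {}" "A \<subseteq> W - K"
      using in_components_nonempty[OF A(1)] in_components_subset[OF A(1)] by simp_all
    have "closure A \<inter> K \<noteq> {}"
    proof
      assume no: "closure A \<inter> K = {}"
      have "W \<inter> closure A = A"
      proof -
        have "closedin (top_of_set (W - K)) A" using A closedin_component by blast
        then have "(W - K) \<inter> closure A = A"
        proof -
          obtain T where T: "closed T" "A = (W - K) \<inter> T" using \<open>closedin _ A\<close> unfolding closedin_closed by metis
          then have "closure A \<subseteq> T" by (intro closure_minimal) auto
          then show ?thesis using T closure_subset[of A] by blast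
        qed
        then show ?thesis using no by auto
      qed
      then have "closedin (top_of_set W) A" by (metis closedin_closed_Int closed_closure)
      moreover have "openin (top_of_set W) A"
      proof (rule openin_trans[OF A(2)])
        have "W - K = W \<inter> - K" by auto
        then show "openin (top_of_set W) (W - K)" using K(1) by (metis openin_open_Int open_Compl)
      qed
      ultimately have "A = W" using W(1) AW by (auto simp: connected_clopen)
      then show False using AW K(2) W0 interior_subset[of W] by blast
    qed
    then obtain k where "k \<in> K" "k \<in> closure A" by auto
    then have "closure A \<inter> (interior V \<inter> interior W) \<noteq> {}"
      using V W0 by (auto simp: neighborhood_def)
    then have "A \<inter> (interior V \<inter> interior W) \<noteq> {}"
      using open_Int_closure_eq_empty[of "interior V \<inter> interior W" A] by (metis Int_commute open_Int open_interior)
    then show ?thesis using interior_subset[of V] by blast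
  qed
  show ?thesis
  proof
    have "K \<union> (C \<inter> interior W) \<union> (C' \<inter> interior W) = interior W"
      using W0 union interior_subset[of W] by auto
    then show "two_sided K (C \<inter> interior W) (C' \<inter> interior W)"
      using op openC openC' disj union by (auto simp: two_sided_def)
  qed (use accum openC openC' CC in auto)
qed

text \<open>From \<open>x\<close>, whose past stays near \<open>K\<close> on the side \<open>P\<close>, follow the orbit to the exit set.  At time \<open>S\<close>
  before the exit the orbit is still near \<open>K\<close>, even if the exit lies far from \<open>K\<close>; and it cannot have
  changed sides, because an orbit outside \<open>K\<close> never meets \<open>K\<close>.\<close>

lemma exit_point_on_side:
  assumes flow: "flow \<phi>" and blk: "isolating_block \<phi> K N Ni No" and sides: "two_sided K P P'"
    and S: "S > 0" "\<And>x. (\<And>t. \<bar>t\<bar> \<le> S \<Longrightarrow> \<phi> x t \<in> N) \<Longrightarrow> x \<in> K \<union> P \<union> P'"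
    and x: "x \<in> P" "backward_orbit \<phi> x \<subseteq> N \<inter> (K \<union> P \<union> P')"
  obtains y where "y \<in> No" "\<forall>t\<le>0. \<phi> y t \<in> N" "\<phi> y (- S) \<in> P"
proof -
  have iso: "isolating_neighborhood \<phi> K N" using blk by (simp add: isolating_block_def)
  then have inv: "invariant \<phi> K" by (simp add: isolating_neighborhood_def)
  have xK: "x \<notin> K" using x(1) sides by (auto simp: two_sided_def)
  have xN: "\<phi> x t \<in> N \<and> \<phi> x t \<in> K \<union> P \<union> P'" if "t \<le> 0" for t
    using x(2) that by (auto simp: backward_orbit_def)
  have "x \<in> N" using xN[of 0] by (simp add: flow_zero[OF flow])
  obtain t where t: "t \<ge> 0" "\<phi> x t \<notin> N"
    using whole_orbit_in_isolating_neighborhood[OF flow iso, of x] xK xN by (meson linear)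
  obtain s where s: "0 \<le> s" "\<And>r. 0 \<le> r \<Longrightarrow> r \<le> s \<Longrightarrow> \<phi> x r \<in> N" "\<phi> x s \<in> No"
    using exit_through_exit_set[OF flow blk \<open>x \<in> N\<close> t] by metis
  define y where "y = \<phi> x s"
  have y: "\<phi> y r = \<phi> x (s + r)" for r by (simp add: y_def flow_add[OF flow])
  have yN: "\<phi> y r \<in> N" if "r \<le> 0" for r
    using that s(2)[of "s + r"] xN[of "s + r"] by (cases "s + r \<ge> 0") (auto simp: y)
  define m where "m = min s S"
  have "\<phi> y ` {..-m} \<subseteq> K \<union> P \<union> P' - K"
  proof
    fix z assume "z \<in> \<phi> y ` {..-m}"
    then obtain r where r: "r \<le> - m" "z = \<phi> y r" by auto
    have "\<phi> y r \<in> K \<union> P \<union> P'"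
    proof (cases "r \<le> - s")
      case True
      then show ?thesis using xN[of "s + r"] by (simp add: y)
    next
      case False
      then have "r \<le> - S" using r by (auto simp: m_def min_def split: if_splits)
      then show ?thesis
        by (intro S(2)) (auto simp: flow_add[OF flow] intro!: yN)
    qed
    then show "z \<in> K \<union> P \<union> P' - K"
      using xK by (simp add: r y invariant_flow_iff[OF flow inv])
  qed
  moreover have "connected (\<phi> y ` {..-m})"
    by (intro connected_continuous_image continuous_on_flow[OF flow] continuous_intros) auto
  moreover have "x \<in> \<phi> y ` {..-m}"
    by (rule image_eqI[of _ _ "- s"]) (auto simp: y flow_zero[OF flow] m_def)
  ultimately have "\<phi> y ` {..-m} \<subseteq> P"
    using connected_stays_on_one_side[OF sides] x(1) by blast
  then have "\<phi> y (- S) \<in> P" by (auto simp: m_def)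
  then show ?thesis using that s(3) yN by (auto simp: y_def)
qed

section \<open>The index forces unstable points onto one side\<close>

text \<open>This is where the index enters: if \<open>N / No\<close> has trivial first Cech cohomology, points whose past
  stays close to \<open>K\<close> cannot lie on both sides of \<open>K\<close>.

  Suppose they do.  The exit points reached after a long stay in \<open>N\<close>, of duration \<open>T\<close> at least, form two
  closed sets according to the side on which the orbit has passed \<open>K\<close>, and a Urysohn function \<open>g\<close> is \<open>1\<close>
  on one of them and \<open>0\<close> on the other.  The map sending \<open>z\<close> to \<open>exp (2 \<pi> i g (z T))\<close>, and to \<open>1\<close> if \<open>z\<close> has left
  \<open>N\<close> before time \<open>T\<close>, is continuous on \<open>N / No\<close>, so it has a lift \<open>h\<close> vanishing on \<open>No\<close>.  Let \<open>y\<close> and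
  \<open>y'\<close> be exit points on the two sides with their pasts in \<open>N\<close>.  The difference \<open>h z - 2 \<pi> g (z T)\<close>
  is constant on the connected set formed by \<open>K\<close> and the closures of the past orbits of \<open>y (-T)\<close> and
  \<open>y' (-T)\<close>.  But \<open>h\<close> vanishes at \<open>y (-T)\<close> and \<open>y' (-T)\<close>, being constant along the orbit segments to
  the exit, whereas \<open>g\<close> is \<open>1\<close> at \<open>y\<close> and \<open>0\<close> at \<open>y'\<close>.

  Working with long orbits makes the argument independent of the size of \<open>N\<close>, which may stick out of
  the neighborhood in which \<open>K\<close> has two sides.\<close>

lemma unstable_points_on_one_side:
  assumes flow: "flow \<phi>" and blk: "isolating_block \<phi> K N Ni No"
    and triv: "trivial_group (block_index_group 1 N No)"
    and conn: "connected K" and sides: "two_sided K P P'"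
    and x: "x \<in> P" "backward_orbit \<phi> x \<subseteq> N \<inter> (K \<union> P \<union> P')"
    and x': "x' \<in> P'" "backward_orbit \<phi> x' \<subseteq> N \<inter> (K \<union> P \<union> P')"
  shows False
proof -
  have iso: "isolating_neighborhood \<phi> K N" using blk by (simp add: isolating_block_def)
  then have inv: "invariant \<phi> K" and cN: "compact N" and KN: "K \<subseteq> interior N"
    by (auto simp: isolating_neighborhood_def neighborhood_def)
  then have clN: "closed N" by (simp add: compact_imp_closed)
  have cNo: "compact No" and NoF: "No \<subseteq> frontier N" using blk by (auto simp: isolating_block_def)
  have NoN: "No \<subseteq> N" using NoF clN by (auto simp: frontier_def)
  have NoK: "No \<inter> K = {}" using NoF KN by (auto simp: frontier_def)
  have KO: "open (K \<union> P \<union> P')" using sides by (simp add: two_sided_def)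
  obtain S :: real where S: "S > 0" "\<And>x. (\<And>t. \<bar>t\<bar> \<le> S \<Longrightarrow> \<phi> x t \<in> N) \<Longrightarrow> x \<in> K \<union> P \<union> P'"
    using long_stay_forces_closeness[OF flow iso KO] by blast
  define T where "T = 2 * S"
  have T: "T > 0" using S by (simp add: T_def)
  obtain y where y: "y \<in> No" "\<forall>t\<le>0. \<phi> y t \<in> N" "\<phi> y (- S) \<in> P"
    by (rule exit_point_on_side[OF flow blk sides S x]) blast
  obtain y' where y': "y' \<in> No" "\<forall>t\<le>0. \<phi> y' t \<in> N" "\<phi> y' (- S) \<in> P'"
    by (rule exit_point_on_side[OF flow blk two_sided_commute[OF sides] S(1) _ x'(1)])
      (use S(2) x'(2) in \<open>auto simp: Un_ac\<close>)
  define B where "B = {z \<in> No. \<forall>t\<in>{-T..0}. \<phi> z t \<in> N}"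
  \<comment> \<open>Points leaving \<open>N\<close> after having spent time \<open>T = 2 S\<close> in it; half way back they were close to \<open>K\<close>,
    which tells the side on which they passed.\<close>
  define E where "E Q = {z \<in> B. \<phi> z (- S) \<in> Q}" for Q
  have clv: "closed ((\<lambda>z. \<phi> z t) -` Q)" if "closed Q" for Q t
    by (intro closed_vimage that continuous_on_flow[OF flow] continuous_intros)
  have "B = No \<inter> (\<Inter>t\<in>{-T..0}. (\<lambda>z. \<phi> z t) -` N)" by (auto simp: B_def)
  then have clB: "closed B"
    using clv[OF clN] compact_imp_closed[OF cNo] by (simp add: closed_Int closed_INT)
  have BE: "z \<in> E P \<or> z \<in> E P'" if "z \<in> B" for z
  proof -
    have zN: "\<phi> z t \<in> N" if "- T \<le> t" "t \<le> 0" for t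
      using \<open>z \<in> B\<close> that by (simp add: B_def)
    have "\<phi> z (- S) \<in> K \<union> P \<union> P'"
      by (intro S(2)) (auto simp: T_def flow_add[OF flow] intro!: zN)
    moreover have "\<phi> z (- S) \<notin> K"
      using that NoK by (auto simp: invariant_flow_iff[OF flow inv] B_def)
    ultimately show ?thesis using that by (auto simp: E_def)
  qed
  have disj: "E P \<inter> E P' = {}" using sides by (auto simp: E_def two_sided_def)
  have "E P = B \<inter> (\<lambda>z. \<phi> z (- S)) -` (- P')" "E P' = B \<inter> (\<lambda>z. \<phi> z (- S)) -` (- P)"
    using disj BE by (auto simp: E_def)
  then have clE: "closed (E P)" "closed (E P')"
    using sides clB by (auto simp: two_sided_def intro!: closed_Int clv)
  have yE: "y \<in> E P" "y' \<in> E P'" using y y' by (auto simp: E_def B_def)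
  \<comment> \<open>A Urysohn function of the two disjoint closed sets.\<close>
  define g where "g z = infdist z (E P') / (infdist z (E P) + infdist z (E P'))" for z
  have pos: "infdist z (E P) + infdist z (E P') > 0" for z
  proof (cases "z \<in> E P")
    case True
    then show ?thesis
      using infdist_pos_not_in_closed[OF clE(2), of z] yE disj infdist_nonneg[of z "E P"] by force
  next
    case False
    then show ?thesis
      using infdist_pos_not_in_closed[OF clE(1), of z] yE infdist_nonneg[of z "E P'"] by force
  qed
  have gcont: "continuous_on UNIV g"
    unfolding g_def using pos by (intro continuous_intros) (auto simp: less_le)
  have g1: "g z = 1" if "z \<in> E P" for z
    using pos[of z] that by (simp add: g_def)
  have g0: "g z = 0" if "z \<in> E P'" for z
    using that by (simp add: g_def)
  \<comment> \<open>The points that survive up to time \<open>T\<close>, and those that meet the exit set by then.  On the overlap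
    exit happens exactly at time \<open>T\<close>, where \<open>g\<close> is \<open>0\<close> or \<open>1\<close>; so the two formulas for \<open>u\<close> match.\<close>
  define D where "D = {z \<in> N. \<forall>t\<in>{0..T}. \<phi> z t \<in> N}"
  define D' where "D' = {z \<in> N. \<exists>s\<in>{0..T}. \<phi> z s \<in> No}"
  have "D = N \<inter> (\<Inter>t\<in>{0..T}. (\<lambda>z. \<phi> z t) -` N)" by (auto simp: D_def)
  then have clD: "closed D" using clv[OF clN] clN by (simp add: closed_Int closed_INT)
  have "compact (N \<times> {0..T} \<inter> (\<lambda>z. \<phi> (fst z) (snd z)) -` No)"
    by (intro compact_Int_closed compact_Times cN compact_Icc closed_vimage compact_imp_closed[OF cNo]
        continuous_on_flow[OF flow] continuous_intros)
  then have "compact (fst ` (N \<times> {0..T} \<inter> (\<lambda>z. \<phi> (fst z) (snd z)) -` No))"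
    by (intro compact_continuous_image continuous_intros)
  moreover have "fst ` (N \<times> {0..T} \<inter> (\<lambda>z. \<phi> (fst z) (snd z)) -` No) = D'"
    by (force simp: D'_def)
  ultimately have clD': "closed D'" by (simp add: compact_imp_closed)
  have DD': "D \<union> D' = N"
  proof -
    have "z \<in> D'" if "z \<in> N" "z \<notin> D" for z
    proof -
      obtain t where t: "t \<ge> 0" "t \<le> T" "\<phi> z t \<notin> N" using \<open>z \<in> N\<close> \<open>z \<notin> D\<close> by (auto simp: D_def)
      obtain s where "0 \<le> s" "s < t" "\<phi> z s \<in> No"
        using exit_through_exit_set[OF flow blk \<open>z \<in> N\<close> t(1,3)] by blast
      then show ?thesis using \<open>z \<in> N\<close> t by (force simp: D'_def)
    qed
    then show ?thesis by (auto simp: D_def D'_def)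
  qed
  have DintD': "\<phi> z T \<in> E P \<or> \<phi> z T \<in> E P'" if D: "z \<in> D" "z \<in> D'" for z
  proof -
    obtain s where s: "0 \<le> s" "s \<le> T" "\<phi> z s \<in> No" using D by (auto simp: D'_def)
    have "s = T"
    proof (rule ccontr)
      assume "s \<noteq> T"
      obtain d where d: "d > 0" "\<forall>t\<in>{0<..d}. \<phi> (\<phi> z s) t \<notin> N"
        using blk s(3) unfolding isolating_block_def by blast
      have "\<phi> (\<phi> z s) (min d (T - s)) \<notin> N" using d s \<open>s \<noteq> T\<close> by auto
      moreover have "\<phi> z (s + min d (T - s)) \<in> N" using D(1) d s by (auto simp: D_def)
      ultimately show False by (simp add: flow_add[OF flow])
    qed
    then have "\<phi> z T \<in> B" using s D(1) by (auto simp: B_def D_def flow_add[OF flow])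
    then show ?thesis by (rule BE)
  qed
  define u where "u z = (if z \<in> D then cis (2 * pi * g (\<phi> z T)) else 1)" for z
  have seam: "cis (2 * pi * g (\<phi> z T)) = 1" if "z \<in> D" "z \<in> D'" for z
    using DintD'[OF that] by (elim disjE) (simp_all only: g0 g1 mult_zero_right mult_1_right cis_2pi cis_zero)
  then have uD': "u z = 1" if "z \<in> D'" for z
    using that by (simp add: u_def)
  have gTcont: "continuous_on A (\<lambda>z. g (\<phi> z T))" for A
    by (intro continuous_on_compose2[OF gcont] continuous_on_flow[OF flow] continuous_intros) auto
  have "continuous_on (D \<union> D') u"
    unfolding u_def
  proof (rule continuous_on_cases[OF clD clD'])
    show "continuous_on D (\<lambda>z. cis (2 * pi * g (\<phi> z T)))"
      using gTcont by (intro continuous_intros) auto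
    show "\<forall>z. z \<in> D \<and> z \<notin> D \<or> z \<in> D' \<and> z \<in> D \<longrightarrow> cis (2 * pi * g (\<phi> z T)) = 1"
      using seam by blast
  qed (rule continuous_on_const)
  then have ucont: "continuous_on N u" by (simp add: DD')
  have NoD': "z \<in> D'" if "z \<in> No" for z
  proof -
    have "\<phi> z 0 \<in> No" "0 \<in> {0..T}" using that T by (auto simp: flow_zero[OF flow])
    then show ?thesis using that NoN unfolding D'_def by blast
  qed
  have "norm (u z) = 1" for z by (simp add: u_def)
  then obtain h where h: "continuous_on N h" "\<And>z. z \<in> N \<inter> No \<Longrightarrow> h z = 0" "\<And>z. z \<in> N \<Longrightarrow> u z = cis (h z)"
    using circle_map_lift_if_block_index_trivial[OF triv ucont] uD' NoD' by metis
  \<comment> \<open>On \<open>D\<close> both \<open>h\<close> and \<open>2 \<pi> g(z T)\<close> lift \<open>u\<close>, so \<open>w\<close> takes values in \<open>2 \<pi> \<int>\<close>.\<close>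
  define w where "w z = h z - 2 * pi * g (\<phi> z T)" for z
  have wcont: "continuous_on D w"
    unfolding w_def using gTcont h(1) DD' by (intro continuous_intros) (auto intro: continuous_on_subset)
  have w1: "cis (w z) = 1" if "z \<in> D" for z
    using h(3)[of z] that DD' UnI1[OF that, of D'] by (simp add: w_def u_def cis_divide[symmetric])
  have start: "h (\<phi> v (- T)) = 0 \<and> backward_orbit \<phi> (\<phi> v (- T)) \<subseteq> D"
    if v: "v \<in> No" "\<forall>t\<le>0. \<phi> v t \<in> N" for v
  proof
    let ?J = "\<phi> v ` {-T..0}"
    have JD': "?J \<subseteq> D'"
    proof clarify
      fix r assume "r \<in> {-T..0}"
      then show "\<phi> v r \<in> D'"
        using v flow_zero[OF flow] by (auto simp: D'_def flow_add[OF flow] intro!: bexI[of _ "- r"])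
    qed
    have "h (\<phi> v (- T)) = h (\<phi> v 0)"
    proof (rule integer_lift_constant[of ?J])
      show "connected ?J"
        by (intro connected_continuous_image continuous_on_flow[OF flow] continuous_intros) auto
      show "continuous_on ?J h" using h(1) by (rule continuous_on_subset) (use v in auto)
      show "cis (h z) = 1" if "z \<in> ?J" for z
        using that JD' uD' h(3)[of z] DD' by auto
    qed (use T in auto)
    then show "h (\<phi> v (- T)) = 0" using h(2)[of v] v NoN by (auto simp: flow_zero[OF flow])
    show "backward_orbit \<phi> (\<phi> v (- T)) \<subseteq> D"
      using v(2) T by (auto simp: D_def backward_orbit_def flow_add[OF flow])
  qed
  \<comment> \<open>The backward orbits of the two starting points are tied together by \<open>K\<close>.\<close>
  define L where "L v = closure (backward_orbit \<phi> (\<phi> v (- T)))" for v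
  have L: "L v \<subseteq> D" "connected (L v)" "L v \<inter> K \<noteq> {}" "\<phi> v (- T) \<in> L v"
    if v: "v \<in> No" "\<forall>t\<le>0. \<phi> v t \<in> N" for v
  proof -
    let ?z = "\<phi> v (- T)"
    show "L v \<subseteq> D" unfolding L_def using start[OF v] clD by (simp add: closure_minimal)
    have "connected (\<phi> ?z ` {..0})"
      by (intro connected_continuous_image continuous_on_flow[OF flow] continuous_intros) auto
    moreover have "\<phi> ?z ` {..0} = backward_orbit \<phi> ?z" by (auto simp: backward_orbit_def)
    ultimately show "connected (L v)" unfolding L_def by (simp add: connected_imp_connected_closure)
    have "backward_orbit \<phi> ?z \<subseteq> N" using start[OF v] DD' by auto
    then show "L v \<inter> K \<noteq> {}"
      unfolding L_def by (rule backward_orbit_accumulates_at_isolated_set[OF flow iso])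
    have "?z \<in> backward_orbit \<phi> ?z"
      by (auto simp: backward_orbit_def flow_zero[OF flow] intro!: exI[of _ 0])
    then show "?z \<in> L v" unfolding L_def by (rule closure_subset[THEN subsetD])
  qed
  have KD: "K \<subseteq> D" using inv KN interior_subset[of N] by (auto simp: D_def invariant_def)
  have "w (\<phi> y (- T)) = w (\<phi> y' (- T))"
  proof (rule integer_lift_constant[of "L y \<union> K \<union> L y'"])
    show "connected (L y \<union> K \<union> L y')"
      using L(2,3)[OF y(1,2)] L(2,3)[OF y'(1,2)] conn by (intro connected_Un) auto
    show "continuous_on (L y \<union> K \<union> L y') w"
      using wcont by (rule continuous_on_subset) (use L(1)[OF y(1,2)] L(1)[OF y'(1,2)] KD in auto)
    show "cis (w z) = 1" if "z \<in> L y \<union> K \<union> L y'" for z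
      using that w1 L(1)[OF y(1,2)] L(1)[OF y'(1,2)] KD by auto
  qed (use L(4)[OF y(1,2)] L(4)[OF y'(1,2)] in auto)
  then show False
    using start[OF y(1,2)] start[OF y'(1,2)] g1[OF yE(1)] g0[OF yE(2)]
    by (simp add: w_def flow_add[OF flow] flow_zero[OF flow])
qed

section \<open>Existence of stable and unstable points\<close>

lemma open_long_stay:
  assumes flow: "flow \<phi>" and G: "open G"
  shows "open {x. \<forall>t\<in>{0..T}. \<phi> x t \<in> G}"
proof -
  have cont: "continuous_on UNIV (\<lambda>z. \<phi> (fst z) (snd z))"
    by (intro continuous_on_flow[OF flow] continuous_intros)
  have op: "open ((\<lambda>z. \<phi> (fst z) (snd z)) -` G)"
    by (intro open_vimage G cont)
  show ?thesis
  proof (subst open_subopen, intro ballI)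
    fix x assume "x \<in> {x. \<forall>t\<in>{0..T}. \<phi> x t \<in> G}"
    then have "{x} \<times> {0..T} \<subseteq> (\<lambda>z. \<phi> (fst z) (snd z)) -` G" by auto
    then obtain X where "x \<in> X" "open X" "X \<times> {0..T} \<subseteq> (\<lambda>z. \<phi> (fst z) (snd z)) -` G"
      using Elementary_Topology.tube_lemma[of "{0..T}" "(\<lambda>z. \<phi> (fst z) (snd z)) -` G" x] op compact_Icc by blast
    then show "\<exists>X. open X \<and> x \<in> X \<and> X \<subseteq> {x. \<forall>t\<in>{0..T}. \<phi> x t \<in> G}"
      by (intro exI[of _ X]) auto
  qed
qed

text \<open>Points of \<open>P\<close> close to \<open>K\<close> need a long time to leave \<open>Q\<close>, and up to then they stay on their side.
  The limits of their exit points have their whole past in \<open>Q\<close>.\<close>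

lemma unstable_point_on_side:
  assumes flow: "flow \<phi>" and iso: "isolating_neighborhood \<phi> K Q" and sides: "two_sided K P P'"
    and Q: "Q \<subseteq> K \<union> P \<union> P'"
    and leave: "\<And>V. neighborhood K V \<Longrightarrow> \<exists>x\<in>V \<inter> P. \<not> forward_orbit \<phi> x \<subseteq> Q"
  shows "\<exists>y\<in>P. backward_orbit \<phi> y \<subseteq> Q"
proof -
  have inv: "invariant \<phi> K" and cQ: "compact Q" and KQ: "K \<subseteq> interior Q"
    using iso by (auto simp: isolating_neighborhood_def neighborhood_def)
  have clQ: "closed Q" by (simp add: cQ compact_imp_closed)
  \<comment> \<open>Long forward orbit segments in \<open>Q\<close> on the side of \<open>P\<close> that end on the frontier of \<open>Q\<close>.\<close>
  have "\<exists>x s. real n < s \<and> (\<forall>r. 0 \<le> r \<longrightarrow> r \<le> s \<longrightarrow> \<phi> x r \<in> Q) \<and> \<phi> x s \<in> frontier Q \<and> \<phi> x s \<in> P" for n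
  proof -
    define G where "G = {x. \<forall>t\<in>{0..real n}. \<phi> x t \<in> interior Q}"
    have "open G" unfolding G_def by (rule open_long_stay[OF flow]) simp
    moreover have "K \<subseteq> G" using inv KQ by (auto simp: G_def invariant_def)
    ultimately have "neighborhood K G" by (simp add: neighborhood_def interior_open)
    then obtain x where x: "x \<in> G" "x \<in> P" "\<not> forward_orbit \<phi> x \<subseteq> Q" using leave by blast
    have xG: "\<phi> x t \<in> interior Q" if "0 \<le> t" "t \<le> real n" for t using x(1) that by (auto simp: G_def)
    have xQ: "x \<in> Q" using xG[of 0] interior_subset by (auto simp: flow_zero[OF flow])
    obtain t where t: "t \<ge> 0" "\<phi> x t \<notin> Q" using x(3) by (auto simp: forward_orbit_def)
    obtain s where s: "0 \<le> s" "\<And>r. 0 \<le> r \<Longrightarrow> r \<le> s \<Longrightarrow> \<phi> x r \<in> Q" "\<phi> x s \<in> frontier Q"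
      using first_exit[OF flow clQ xQ t] by metis
    have "real n < s"
    proof (rule ccontr)
      assume "\<not> real n < s"
      then have "\<phi> x s \<in> interior Q" using xG s(1) by simp
      then show False using s(3) by (simp add: frontier_def)
    qed
    have xK: "x \<notin> K" using x(2) sides by (auto simp: two_sided_def)
    have "\<phi> x ` {0..s} \<subseteq> P"
    proof (rule connected_stays_on_one_side[OF sides])
      show "connected (\<phi> x ` {0..s})"
        by (intro connected_continuous_image continuous_on_flow[OF flow] continuous_intros) auto
      show "\<phi> x ` {0..s} \<subseteq> K \<union> P \<union> P' - K"
      proof
        fix z assume "z \<in> \<phi> x ` {0..s}"
        then obtain r where r: "0 \<le> r" "r \<le> s" "z = \<phi> x r" by auto
        then have "z \<in> Q" using s(2) by blast
        then show "z \<in> K \<union> P \<union> P' - K" using Q xK r(3) by (auto simp: invariant_flow_iff[OF flow inv])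
      qed
      show "x \<in> \<phi> x ` {0..s}" by (rule image_eqI[of _ _ 0]) (use s in \<open>auto simp: flow_zero[OF flow]\<close>)
    qed (fact x(2))
    then have "\<phi> x s \<in> P" using s(1) by auto
    then show ?thesis using s \<open>real n < s\<close> by blast
  qed
  then obtain X s where X: "\<And>n. real n < s n" "\<And>n r. 0 \<le> r \<Longrightarrow> r \<le> s n \<Longrightarrow> \<phi> (X n) r \<in> Q"
    "\<And>n. \<phi> (X n) (s n) \<in> frontier Q" "\<And>n. \<phi> (X n) (s n) \<in> P"
    by metis
  \<comment> \<open>A limit of their end points has its whole past in \<open>Q\<close>.\<close>
  define Y where "Y n = \<phi> (X n) (s n)" for n
  have "compact (Q \<inter> frontier Q)" using cQ by (intro compact_Int_closed frontier_closed)
  then have "compact (frontier Q)" using clQ by (simp add: frontier_subset_closed Int_absorb1)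
  then obtain y r where y: "y \<in> frontier Q" "strict_mono r" "((Y \<circ> r) \<longlongrightarrow> y) sequentially"
    using X(3) unfolding compact_def Y_def by metis
  have yQ: "\<phi> y t \<in> Q" if "t \<le> 0" for t
  proof (rule Lim_in_closed_set[OF clQ])
    show "((\<lambda>n. \<phi> (Y (r n)) t) \<longlongrightarrow> \<phi> y t) sequentially"
      using flow_tendsto[OF flow y(3)[unfolded o_def] tendsto_const] .
    show "\<forall>\<^sub>F n in sequentially. \<phi> (Y (r n)) t \<in> Q"
    proof (rule eventually_sequentiallyI[of "nat \<lceil>\<bar>t\<bar>\<rceil>"])
      fix n assume "nat \<lceil>\<bar>t\<bar>\<rceil> \<le> n"
      then have "\<bar>t\<bar> \<le> real n" by linarith
      also have "real n \<le> real (r n)" using seq_suble[OF y(2)] by simp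
      also have "\<dots> < s (r n)" by (rule X(1))
      finally show "\<phi> (Y (r n)) t \<in> Q" using that by (auto simp: Y_def flow_add[OF flow] intro!: X(2))
    qed
  qed simp
  have "y \<notin> K" using y(1) KQ by (auto simp: frontier_def)
  moreover have "y \<in> - P'"
  proof (rule Lim_in_closed_set[OF _ _ _ y(3)])
    have "P \<subseteq> - P'" using sides by (auto simp: two_sided_def)
    then show "\<forall>\<^sub>F n in sequentially. (Y \<circ> r) n \<in> - P'"
      using X(4) by (intro always_eventually) (auto simp: Y_def)
  qed (use sides in \<open>auto simp: two_sided_def\<close>)
  moreover have "y \<in> Q" using yQ[of 0] by (simp add: flow_zero[OF flow])
  ultimately have "y \<in> P" using Q by auto
  then show ?thesis using yQ by (auto simp: backward_orbit_def)
qed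

lemma stable_or_unstable_point_on_side:
  assumes flow: "flow \<phi>" and iso: "isolating_neighborhood \<phi> K Q" and sides: "two_sided K P P'"
    and Q: "Q \<subseteq> K \<union> P \<union> P'"
    and accum: "\<And>V. neighborhood K V \<Longrightarrow> V \<inter> P \<noteq> {}"
  shows "(\<exists>y\<in>P. backward_orbit \<phi> y \<subseteq> Q) \<or> (\<exists>y\<in>P. forward_orbit \<phi> y \<subseteq> Q)"
proof (cases "\<forall>V. neighborhood K V \<longrightarrow> (\<exists>x\<in>V \<inter> P. \<not> forward_orbit \<phi> x \<subseteq> Q)")
  case True
  then show ?thesis using unstable_point_on_side[OF flow iso sides Q] by blast
next
  case False
  then obtain V where V: "neighborhood K V" "\<And>x. x \<in> V \<inter> P \<Longrightarrow> forward_orbit \<phi> x \<subseteq> Q" by blast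
  then show ?thesis using accum[OF V(1)] by blast
qed

section \<open>Neither saddle nor attractor nor repeller\<close>

text \<open>The past of \<open>y\<close> enters every neighborhood of \<open>K\<close>, and from there the orbit returns to \<open>y\<close>; this
  contradicts stability with respect to the complement of \<open>y\<close>.\<close>

lemma not_attractor_if_unstable_point:
  assumes flow: "flow \<phi>" and iso: "isolating_neighborhood \<phi> K Q"
    and y: "y \<notin> K" "backward_orbit \<phi> y \<subseteq> Q"
  shows "\<not> attractor \<phi> K"
proof
  assume "attractor \<phi> K"
  then have stable: "\<And>U. neighborhood K U \<Longrightarrow> \<exists>V. neighborhood K V \<and> (\<forall>x\<in>V. forward_orbit \<phi> x \<subseteq> U)"
    and "closed K"
    by (auto simp: attractor_def compact_imp_closed)
  have "neighborhood K (- {y})" using y(1) interior_open[OF open_Compl[OF closed_singleton[of y]]]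
    by (auto simp: neighborhood_def)
  then obtain V where V: "neighborhood K V" "\<And>x. x \<in> V \<Longrightarrow> forward_orbit \<phi> x \<subseteq> - {y}"
    using stable by blast
  have "closure (backward_orbit \<phi> y) \<inter> interior V \<noteq> {}"
    using backward_orbit_accumulates_at_isolated_set[OF flow iso y(2)] V(1)
    by (auto simp: neighborhood_def)
  then have "backward_orbit \<phi> y \<inter> interior V \<noteq> {}"
    using open_Int_closure_eq_empty[OF open_interior] by (metis Int_commute)
  then obtain t where t: "t \<le> 0" "\<phi> y t \<in> V"
    using interior_subset by (auto simp: backward_orbit_image)
  have "\<phi> (\<phi> y t) (- t) = y" by (simp add: flow_add[OF flow] flow_zero[OF flow])
  then have "y \<in> forward_orbit \<phi> (\<phi> y t)"
    using t(1) unfolding forward_orbit_image by (intro image_eqI[of _ _ "- t"]) auto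
  then show False using V(2)[OF t(2)] by auto
qed

text \<open>Each side carries a point whose past, or a point whose future, stays near \<open>K\<close>.  By the triviality
  of the indices neither kind occurs on both sides, so one side is purely unstable and the other one
  purely stable.\<close>

lemma non_saddle_if_indices_trivial:
  assumes flow: "flow \<phi>" and K: "compact K" "connected K" and sides: "two_sided K P P'"
    and accum: "\<And>V. neighborhood K V \<Longrightarrow> V \<inter> P \<noteq> {}" "\<And>V. neighborhood K V \<Longrightarrow> V \<inter> P' \<noteq> {}"
    and plus: "trivial_CH_plus 1 \<phi> K" and minus: "trivial_CH_minus 1 \<phi> K"
  shows "non_saddle \<phi> K \<and> \<not> attractor \<phi> K \<and> \<not> repeller \<phi> K"
proof -
  obtain N Ni No where N: "isolating_block \<phi> K N Ni No" "trivial_group (block_index_group 1 N No)"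
    using plus by (auto simp: trivial_CH_plus_def)
  obtain M Mi Mo where M: "isolating_block \<phi> K M Mi Mo" "trivial_group (block_index_group 1 M Mi)"
    using minus by (auto simp: trivial_CH_minus_def)
  have isoN: "isolating_neighborhood \<phi> K N" and isoM: "isolating_neighborhood \<phi> K M"
    using N M by (auto simp: isolating_block_def)
  have inv: "invariant \<phi> K" using isoN by (simp add: isolating_neighborhood_def)
  note rflow = flow_reverse[OF flow]
  \<comment> \<open>The two index groups may come from different blocks, so everything happens inside both.\<close>
  define G where "G = interior N \<inter> interior M \<inter> (K \<union> P \<union> P')"
  have G: "open G" "K \<subseteq> G"
    using isoN isoM sides by (auto simp: G_def isolating_neighborhood_def neighborhood_def two_sided_def)
  have GNM: "G \<subseteq> N" "G \<subseteq> M" "G \<subseteq> K \<union> P \<union> P'"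
    using interior_subset by (auto simp: G_def)
  define un where "un A Q \<longleftrightarrow> (\<exists>y\<in>A. backward_orbit \<phi> y \<subseteq> Q)" for A Q
  define st where "st A Q \<longleftrightarrow> (\<exists>y\<in>A. forward_orbit \<phi> y \<subseteq> Q)" for A Q
  have not_un: "\<not> (un P G \<and> un P' G)"
    using unstable_points_on_one_side[OF flow N K(2) sides] GNM unfolding un_def by blast
  have not_st: "\<not> (st P G \<and> st P' G)"
    using unstable_points_on_one_side[OF rflow isolating_block_reverse[OF M(1)] M(2) K(2) sides] GNM
    unfolding st_def backward_orbit_reverse by blast
  have mono: "un A Q \<Longrightarrow> un A G" "st A Q \<Longrightarrow> st A G" if "Q \<subseteq> G" for A Q
    using that unfolding un_def st_def by blast+
  have some: "un P Q \<or> st P Q" "un P' Q \<or> st P' Q"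
    if Q: "isolating_neighborhood \<phi> K Q" "Q \<subseteq> G" for Q
  proof -
    have "Q \<subseteq> K \<union> P \<union> P'" "Q \<subseteq> K \<union> P' \<union> P" using Q(2) GNM by auto
    then show "un P Q \<or> st P Q" "un P' Q \<or> st P' Q"
      using stable_or_unstable_point_on_side[OF flow Q(1) sides _ accum(1)]
        stable_or_unstable_point_on_side[OF flow Q(1) two_sided_commute[OF sides] _ accum(2)]
      unfolding un_def st_def by blast+
  qed
  have "\<not> saddle \<phi> K"
  proof
    assume "saddle \<phi> K"
    then obtain U where U: "neighborhood K U" and
      leave: "\<And>V. neighborhood K V \<Longrightarrow> \<exists>x\<in>V. \<not> forward_orbit \<phi> x \<subseteq> U \<and> \<not> backward_orbit \<phi> x \<subseteq> U"
      by (auto simp: saddle_def)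
    obtain Q where Q: "isolating_neighborhood \<phi> K Q" "Q \<subseteq> N \<inter> (G \<inter> interior U)"
      using small_isolating_neighborhood[OF isoN K(1), of "G \<inter> interior U"] G U
      by (auto simp: neighborhood_def)
    have QU: "Q \<subseteq> U" "Q \<subseteq> G" using Q(2) interior_subset[of U] by auto
    define L where "L A \<longleftrightarrow> (\<forall>V. neighborhood K V \<longrightarrow>
      (\<exists>x\<in>V \<inter> A. \<not> forward_orbit \<phi> x \<subseteq> Q \<and> \<not> backward_orbit \<phi> x \<subseteq> Q))" for A
    \<comment> \<open>A side with points near \<open>K\<close> leaving in both directions carries both kinds of points, and the
      other side carries at least one; so one of the kinds occurs on both sides.\<close>
    have both: "un A Q \<and> st A Q" if A: "L A" "two_sided K A A'" "Q \<subseteq> K \<union> A \<union> A'" for A A'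
    proof
      show "un A Q"
        using unstable_point_on_side[OF flow Q(1) A(2,3)] A(1) unfolding L_def un_def by blast
      have "isolating_neighborhood (reverse_flow \<phi>) K Q" using Q(1) by simp
      from unstable_point_on_side[OF rflow this A(2,3)] show "st A Q"
        using A(1) unfolding L_def st_def backward_orbit_reverse forward_orbit_reverse by blast
    qed
    have "L P \<or> L P'"
    proof (rule ccontr)
      assume "\<not> (L P \<or> L P')"
      then obtain V V' where V: "neighborhood K V" "neighborhood K V'"
        and stay: "\<And>x. x \<in> V \<inter> P \<Longrightarrow> forward_orbit \<phi> x \<subseteq> Q \<or> backward_orbit \<phi> x \<subseteq> Q"
          "\<And>x. x \<in> V' \<inter> P' \<Longrightarrow> forward_orbit \<phi> x \<subseteq> Q \<or> backward_orbit \<phi> x \<subseteq> Q"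
        unfolding L_def by blast
      have "neighborhood K (V \<inter> V' \<inter> G)" using V G by (auto simp: neighborhood_def interior_open)
      then obtain x where x: "x \<in> V" "x \<in> V'" "x \<in> G" "\<not> forward_orbit \<phi> x \<subseteq> U" "\<not> backward_orbit \<phi> x \<subseteq> U"
        using leave by blast
      have "K \<subseteq> U" using U interior_subset by (auto simp: neighborhood_def)
      then have "x \<notin> K" using x(4) inv by (auto simp: forward_orbit_image invariant_def)
      then have "x \<in> P \<or> x \<in> P'" using x(3) GNM by auto
      then show False using x stay QU(1) by blast
    qed
    then show False
    proof
      assume "L P"
      then have "un P Q \<and> st P Q" using both[OF _ sides] QU GNM by auto
      then show False using some(2)[OF Q(1) QU(2)] not_un not_st mono[OF QU(2)] by blast
    next
      assume "L P'"
      then have "un P' Q \<and> st P' Q" using both[OF _ two_sided_commute[OF sides]] QU GNM by (auto simp: Un_ac)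
      then show False using some(1)[OF Q(1) QU(2)] not_un not_st mono[OF QU(2)] by blast
    qed
  qed
  moreover
  obtain Q where Q: "isolating_neighborhood \<phi> K Q" "Q \<subseteq> N \<inter> G"
    using small_isolating_neighborhood[OF isoN K(1) G] by blast
  have QG: "Q \<subseteq> G" using Q by simp
  have off: "x \<notin> K" if "x \<in> P \<or> x \<in> P'" for x using that sides by (auto simp: two_sided_def)
  have "un P Q \<or> un P' Q" "st P Q \<or> st P' Q"
    using some[OF Q(1) QG] not_un not_st mono[OF QG] by blast+
  then have "\<not> attractor \<phi> K" "\<not> attractor (reverse_flow \<phi>) K"
    using not_attractor_if_unstable_point[OF flow Q(1)] not_attractor_if_unstable_point[OF rflow, of K Q]
      Q(1) off unfolding un_def st_def isolating_neighborhood_reverse backward_orbit_reverse by blast+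
  ultimately show ?thesis
    using K inv by (simp add: non_saddle_def repeller_def)
qed

section \<open>Turning of circle-valued maps along singular simplices\<close>

text \<open>The choice of \<open>g\<close> is immaterial: two lifts of a curve in the unit circle differ by a constant.\<close>

definition turning :: "(real \<Rightarrow> complex) \<Rightarrow> real" where
  "turning v = (SOME d. \<exists>g. continuous_on {0..1} g \<and> (\<forall>t\<in>{0..1}. v t = cis (g t)) \<and> d = g 1 - g 0)"

lemma turning_eq:
  assumes g: "continuous_on {0..1} g" "\<And>t. t \<in> {0..1} \<Longrightarrow> v t = cis (g t)"
  shows "turning v = g 1 - g 0"
  unfolding turning_def
proof (rule some_equality)
  fix d assume "\<exists>g. continuous_on {0..1} g \<and> (\<forall>t\<in>{0..1}. v t = cis (g t)) \<and> d = g 1 - g 0"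
  then obtain h where h: "continuous_on {0..1} h" "\<forall>t\<in>{0..1}. v t = cis (h t)" "d = h 1 - h 0" by blast
  have "h 0 - g 0 = h 1 - g 1"
  proof (rule integer_lift_constant[of "{0..1}" "\<lambda>t. h t - g t"])
    show "cis (h t - g t) = 1" if "t \<in> {0..1}" for t
      using that g(2) h(2) by (simp add: cis_divide[symmetric])
  qed (use g h in \<open>auto intro: continuous_intros\<close>)
  then show "d = g 1 - g 0" using h(3) by simp
qed (use g in blast)

text \<open>Parametrisations of the standard \<open>1\<close>-simplex by the unit interval and of the standard \<open>2\<close>-simplex
  by a triangle in the plane.  They carry lifting problems on simplices, whose points are functions
  on the natural numbers, over to normed spaces.\<close>

definition edge_point :: "real \<Rightarrow> nat \<Rightarrow> real" where
  "edge_point t i = (if i = 0 then 1 - t else if i = 1 then t else 0)"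

definition triangle_point :: "real \<times> real \<Rightarrow> nat \<Rightarrow> real" where
  "triangle_point z i = (if i = 0 then 1 - fst z - snd z else if i = 1 then fst z else if i = 2 then snd z else 0)"

lemma continuous_map_into_standard_simplex:
  assumes "\<And>z. z \<in> S \<Longrightarrow> e z \<in> standard_simplex p" "\<And>i. continuous_on S (\<lambda>z. e z i)"
  shows "continuous_map (top_of_set S) (subtopology (powertop_real UNIV) (standard_simplex p)) e"
  using assms by (auto simp: continuous_map_in_subtopology continuous_map_componentwise_UNIV)

lemma edge_point_in_simplex: "t \<in> {0..1} \<Longrightarrow> edge_point t \<in> standard_simplex 1"
  by (auto simp: standard_simplex_def edge_point_def)

lemma triangle_point_in_simplex:
  "0 \<le> fst z \<Longrightarrow> 0 \<le> snd z \<Longrightarrow> fst z + snd z \<le> 1 \<Longrightarrow> triangle_point z \<in> standard_simplex 2"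
  by (auto simp: standard_simplex_def triangle_point_def numeral_2_eq_2)

lemma continuous_map_triangle_point:
  assumes "\<And>z. z \<in> S \<Longrightarrow> 0 \<le> fst z \<and> 0 \<le> snd z \<and> fst z + snd z \<le> 1"
  shows "continuous_map (top_of_set S) (subtopology (powertop_real UNIV) (standard_simplex 2)) triangle_point"
proof (rule continuous_map_into_standard_simplex)
  show "continuous_on S (\<lambda>z. triangle_point z i)" for i
    unfolding triangle_point_def
    by (cases "i = 0"; cases "i = 1"; cases "i = 2") (auto intro!: continuous_intros)
qed (use assms in \<open>auto intro: triangle_point_in_simplex\<close>)

definition path_simplex :: "(real \<Rightarrow> 'a) \<Rightarrow> (nat \<Rightarrow> real) \<Rightarrow> 'a" where
  "path_simplex p = restrict (\<lambda>x. p (x 1)) (standard_simplex 1)"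

lemma singular_simplex_path_simplex:
  assumes "pathin X p" shows "singular_simplex 1 X (path_simplex p)"
proof -
  let ?D = "subtopology (powertop_real UNIV) (standard_simplex 1)"
  have "continuous_map ?D (top_of_set {0..1}) (\<lambda>x. x 1)"
    by (auto simp: continuous_map_in_subtopology standard_simplex_def
        intro!: continuous_map_from_subtopology continuous_map_product_projection)
  then have "continuous_map ?D X (p \<circ> (\<lambda>x. x 1))"
    using assms by (auto simp: pathin_def intro: continuous_map_compose)
  then have "continuous_map ?D X (path_simplex p)"
    by (rule continuous_map_eq) (auto simp: path_simplex_def)
  then show ?thesis by (simp add: singular_simplex_def path_simplex_def)
qed

text \<open>The additive extension of a function from the generators to a free Abelian group, with the integers
  seen as the free group on one generator.\<close>

definition frag_eval :: "('b \<Rightarrow> int) \<Rightarrow> ('b \<Rightarrow>\<^sub>0 int) \<Rightarrow> int" where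
  "frag_eval \<phi> a = poly_mapping.lookup (frag_extend (\<lambda>\<sigma>. frag_cmul (\<phi> \<sigma>) (frag_of ())) a) ()"

lemma frag_eval_of [simp]: "frag_eval \<phi> (frag_of \<sigma>) = \<phi> \<sigma>"
  and frag_eval_0 [simp]: "frag_eval \<phi> 0 = 0"
  and frag_eval_add: "frag_eval \<phi> (a + b) = frag_eval \<phi> a + frag_eval \<phi> b"
  and frag_eval_diff: "frag_eval \<phi> (a - b) = frag_eval \<phi> a - frag_eval \<phi> b"
  and frag_eval_cmul: "frag_eval \<phi> (frag_cmul n a) = n * frag_eval \<phi> a"
  by (simp_all add: frag_eval_def frag_extend_add frag_extend_diff frag_extend_cmul lookup_add lookup_minus)

text \<open>The turning of \<open>u\<close> along a \<open>1\<close>-simplex is real-valued.  Subtracting the coboundary of the discontinuous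
  cochain \<open>Arg (u x)\<close> leaves an integer multiple of \<open>2 \<pi>\<close>, so the floor is exact; along loops nothing
  is changed.\<close>

definition turning_cochain :: "('a \<Rightarrow> complex) \<Rightarrow> ((nat \<Rightarrow> real) \<Rightarrow> 'a) \<Rightarrow> int" where
  "turning_cochain u \<sigma> = \<lfloor>(turning (\<lambda>t. u (\<sigma> (edge_point t)))
      - (Arg (u (\<sigma> (edge_point 1))) - Arg (u (\<sigma> (edge_point 0))))) / (2 * pi)\<rfloor>"

lemma turning_cochain_eq:
  assumes g: "continuous_on {0..1} g" "\<And>t. t \<in> {0..1} \<Longrightarrow> u (\<sigma> (edge_point t)) = cis (g t)"
  shows "2 * pi * of_int (turning_cochain u \<sigma>)
    = (g 1 - Arg (u (\<sigma> (edge_point 1)))) - (g 0 - Arg (u (\<sigma> (edge_point 0))))"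
proof -
  have arg: "\<exists>n::int. Arg (u (\<sigma> (edge_point t))) = g t + 2 * pi * n" if "t \<in> {0..1}" for t
  proof -
    have "cis (Arg (u (\<sigma> (edge_point t)))) = cis (g t)"
      using g(2)[OF that] by (simp add: cis_Arg sgn_div_norm)
    then show ?thesis by (simp add: cis_eq_iff_int)
  qed
  obtain m n :: int where mn: "Arg (u (\<sigma> (edge_point 0))) = g 0 + 2 * pi * m" "Arg (u (\<sigma> (edge_point 1))) = g 1 + 2 * pi * n"
    using arg[of 0] arg[of 1] by auto
  have t: "turning (\<lambda>t. u (\<sigma> (edge_point t))) = g 1 - g 0"
    by (rule turning_eq[OF g])
  have "turning_cochain u \<sigma> = \<lfloor>2 * pi * of_int (m - n) / (2 * pi)\<rfloor>"
    unfolding turning_cochain_def t mn by (simp add: algebra_simps)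
  then have diff: "turning_cochain u \<sigma> = m - n" by simp
  show ?thesis by (simp add: mn diff algebra_simps)
qed

text \<open>The map \<open>u\<close> has a lift over the whole triangle, whose changes along the three edges cancel.\<close>

lemma turning_cochain_cocycle:
  assumes u: "continuous_map X euclidean u" and u1: "\<And>x. x \<in> topspace X \<Longrightarrow> norm (u x) = 1"
    and \<tau>: "singular_simplex 2 X \<tau>"
  shows "frag_eval (turning_cochain u) (chain_boundary 2 (frag_of \<tau>)) = 0"
proof -
  define Tr where "Tr = {z :: real \<times> real. 0 \<le> fst z \<and> 0 \<le> snd z \<and> fst z + snd z \<le> 1}"
  let ?D = "subtopology (powertop_real UNIV) (standard_simplex 2)"
  have tri: "continuous_map (top_of_set Tr) ?D triangle_point"
    by (rule continuous_map_triangle_point) (simp add: Tr_def)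
  have \<tau>c: "continuous_map ?D X \<tau>" using \<tau> by (simp add: singular_simplex_def)
  have "continuous_map (top_of_set Tr) euclidean (u \<circ> (\<tau> \<circ> triangle_point))"
    by (intro continuous_map_compose[OF _ u] continuous_map_compose[OF tri \<tau>c])
  moreover have "\<tau> (triangle_point z) \<in> topspace X" if "z \<in> Tr" for z
    using continuous_map_funspace[OF continuous_map_compose[OF tri \<tau>c]] that by auto
  moreover have "convex Tr"
  proof -
    have "Tr = {z. (-1, 0) \<bullet> z \<le> 0} \<inter> {z. (0, -1) \<bullet> z \<le> 0} \<inter> {z. (1, 1) \<bullet> z \<le> 1}"
      by (auto simp: Tr_def inner_prod_def)
    then show ?thesis by (simp add: convex_Int convex_halfspace_le)
  qed
  ultimately obtain G where G: "continuous_on Tr G" "\<And>z. z \<in> Tr \<Longrightarrow> u (\<tau> (triangle_point z)) = cis (G z)"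
    using circle_map_lift_on_convex[of Tr "\<lambda>z. u (\<tau> (triangle_point z))"] u1 by (auto simp: o_def)
  \<comment> \<open>On each edge, the cochain is the difference of the end point values of \<open>B / (2 \<pi>)\<close>.\<close>
  define B where "B z = G z - Arg (u (\<tau> (triangle_point z)))" for z
  have face: "2 * pi * of_int (turning_cochain u (singular_face 2 k \<tau>)) = B (s 1) - B (s 0)"
    if s: "continuous_on {0..1} s" "\<And>t. t \<in> {0..1} \<Longrightarrow> s t \<in> Tr"
      "\<And>t. t \<in> {0..1} \<Longrightarrow> simplical_face k (edge_point t) = triangle_point (s t)" for k s
  proof -
    have eq: "singular_face 2 k \<tau> (edge_point t) = \<tau> (triangle_point (s t))" if "t \<in> {0..1}" for t
      using s(3)[OF that] edge_point_in_simplex[OF that] by (simp add: singular_face_def)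
    have "2 * pi * of_int (turning_cochain u (singular_face 2 k \<tau>))
      = (G (s 1) - Arg (u (singular_face 2 k \<tau> (edge_point 1)))) -
        (G (s 0) - Arg (u (singular_face 2 k \<tau> (edge_point 0))))"
    proof (rule turning_cochain_eq)
      show "continuous_on {0..1} (\<lambda>t. G (s t))"
        using s by (intro continuous_on_compose2[OF G(1) s(1)]) auto
      show "u (singular_face 2 k \<tau> (edge_point t)) = cis (G (s t))" if "t \<in> {0..1}" for t
        using eq[OF that] G(2) s(2)[OF that] by simp
    qed
    then show ?thesis using eq[of 0] eq[of 1] by (simp add: B_def)
  qed
  have f0: "2 * pi * of_int (turning_cochain u (singular_face 2 0 \<tau>)) = B (0, 1) - B (1, 0)"
  proof -
    have "simplical_face 0 (edge_point t) = triangle_point (1 - t, t)" for t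
      by (auto simp: fun_eq_iff simplical_face_def edge_point_def triangle_point_def)
    then show ?thesis using face[of "\<lambda>t. (1 - t, t)" 0] by (simp add: Tr_def continuous_intros)
  qed
  have f1: "2 * pi * of_int (turning_cochain u (singular_face 2 1 \<tau>)) = B (0, 1) - B (0, 0)"
  proof -
    have "simplical_face 1 (edge_point t) = triangle_point (0, t)" for t
      by (auto simp: fun_eq_iff simplical_face_def edge_point_def triangle_point_def)
    then show ?thesis using face[of "\<lambda>t. (0, t)" 1] by (simp add: Tr_def continuous_intros)
  qed
  have f2: "2 * pi * of_int (turning_cochain u (singular_face 2 2 \<tau>)) = B (1, 0) - B (0, 0)"
  proof -
    have "simplical_face 2 (edge_point t) = triangle_point (t, 0)" for t
      by (auto simp: fun_eq_iff simplical_face_def edge_point_def triangle_point_def)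
    then show ?thesis using face[of "\<lambda>t. (t, 0)" 2] by (simp add: Tr_def continuous_intros)
  qed
  have "2 * pi * of_int (turning_cochain u (singular_face 2 0 \<tau>) - turning_cochain u (singular_face 2 1 \<tau>)
      + turning_cochain u (singular_face 2 2 \<tau>)) = (0::real)"
    using f0 f1 f2 by (simp add: algebra_simps)
  then have "turning_cochain u (singular_face 2 0 \<tau>) - turning_cochain u (singular_face 2 1 \<tau>)
      + turning_cochain u (singular_face 2 2 \<tau>) = 0"
    using pi_neq_zero by (metis mult_eq_0_iff of_int_eq_0_iff zero_neq_numeral)
  then show ?thesis
    by (simp add: chain_boundary_of numeral_2_eq_2 frag_eval_add frag_eval_diff frag_eval_cmul)
qed

lemma trivial_singular_cocycle_is_coboundary:
  assumes triv: "trivial_group (singular_cohomology_group (Suc q) X)" and c: "c \<in> singular_cocycles (Suc q) X"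
  obtains b where "b \<in> carrier (singular_cochain_group q X)" "c = singular_coboundary_map q X b"
proof -
  let ?C = "singular_cochain_group (Suc q) X\<lparr>carrier := singular_cocycles (Suc q) X\<rparr>"
  let ?B = "singular_coboundaries (Suc q) X"
  have "?B #>\<^bsub>?C\<^esub> c \<in> carrier (?C Mod ?B)"
    using c by (auto simp: FactGroup_def RCOSETS_def)
  then have coset: "?B #>\<^bsub>?C\<^esub> c = ?B"
    using triv by (auto simp: trivial_group_def singular_cohomology_group_def FactGroup_def)
  \<comment> \<open>\<open>z\<close> shows that the zero cochain is a coboundary, so that \<open>c\<close> lies in its own coset.\<close>
  define z where "z = restrict (\<lambda>_. 0 :: int) (singular_chain_set q X)"
  have "z \<in> carrier (singular_cochain_group q X)"
    by (auto simp: z_def singular_cochain_group_def hom_def singular_chain_add)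
  moreover have "singular_coboundary_map q X z = restrict (\<lambda>_. 0) (singular_chain_set (Suc q) X)"
    using singular_chain_boundary[of "Suc q" X] by (auto simp: singular_coboundary_map_def z_def fun_eq_iff)
  ultimately have "restrict (\<lambda>_. 0) (singular_chain_set (Suc q) X) \<in> ?B"
    by (auto simp: singular_coboundaries_def intro!: image_eqI[of _ _ z])
  moreover have "restrict (\<lambda>_. 0) (singular_chain_set (Suc q) X) \<otimes>\<^bsub>?C\<^esub> c = c"
    using c by (auto simp: singular_cocycles_def singular_cochain_group_def fun_eq_iff extensional_def)
  ultimately have "c \<in> ?B #>\<^bsub>?C\<^esub> c" by (force simp: r_coset_def)
  then show ?thesis using that unfolding coset by (auto simp: singular_coboundaries_def)
qed

text \<open>If the turning cocycle is the coboundary of \<open>b\<close>, its values on the two halves of a loop are opposite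
  differences of values of \<open>b\<close>.\<close>

lemma turning_of_loop_zero_if_H1_trivial:
  assumes triv: "trivial_group (singular_cohomology_group 1 X)"
    and u: "continuous_map X euclidean u" and u1: "\<And>x. x \<in> topspace X \<Longrightarrow> norm (u x) = 1"
    and \<alpha>: "pathin X \<alpha>" "continuous_on {0..1} g" "\<And>t. t \<in> {0..1} \<Longrightarrow> u (\<alpha> t) = cis (g t)"
    and \<beta>: "pathin X \<beta>" "continuous_on {0..1} h" "\<And>t. t \<in> {0..1} \<Longrightarrow> u (\<beta> t) = cis (h t)"
    and loop: "\<alpha> 1 = \<beta> 0" "\<beta> 1 = \<alpha> 0"
  shows "(g 1 - g 0) + (h 1 - h 0) = 0"
proof -
  define c where "c = restrict (frag_eval (turning_cochain u)) (singular_chain_set 1 X)"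
  have cycle: "frag_eval (turning_cochain u) (chain_boundary 2 a) = 0" if "singular_chain 2 X a" for a
    using that unfolding singular_chain_def
  proof (induction a rule: frag_induction)
    case (one \<tau>)
    then show ?case using turning_cochain_cocycle[OF u u1] by simp
  qed (simp_all add: chain_boundary_diff frag_eval_diff)
  have "c \<in> carrier (singular_cochain_group 1 X)"
    by (auto simp: c_def singular_cochain_group_def hom_def singular_chain_add frag_eval_add)
  moreover have "singular_coboundary_map 1 X c = \<one>\<^bsub>singular_cochain_group (Suc 1) X\<^esub>"
    using singular_chain_boundary[of 2 X] cycle
    by (auto simp: singular_coboundary_map_def singular_cochain_group_def c_def fun_eq_iff numeral_2_eq_2)
  ultimately have "c \<in> singular_cocycles (Suc 0) X" by (simp add: singular_cocycles_def)
  then obtain b where b: "b \<in> carrier (singular_cochain_group 0 X)" "c = singular_coboundary_map 0 X b"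
    using trivial_singular_cocycle_is_coboundary triv by (metis One_nat_def)
  have b_diff: "b (x - y) = b x - b y" if "singular_chain 0 X x" "singular_chain 0 X y" for x y
  proof -
    have "b (x' + y) = b x' + b y" if "singular_chain 0 X x'" for x'
      using b(1) that \<open>singular_chain 0 X y\<close> by (auto simp: singular_cochain_group_def hom_def)
    from this[OF singular_chain_diff[OF that]] show ?thesis by simp
  qed
  define pt where "pt x = frag_of (restrict (\<lambda>_. x) (standard_simplex 0))" for x :: 'a
  have path: "2 * pi * of_int (b (pt (p 1)) - b (pt (p 0))) = (k 1 - Arg (u (p 1))) - (k 0 - Arg (u (p 0)))"
    if p: "pathin X p" "continuous_on {0..1} k" "\<And>t. t \<in> {0..1} \<Longrightarrow> u (p t) = cis (k t)" for p k
  proof -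
    let ?\<sigma> = "path_simplex p"
    have \<sigma>: "singular_simplex 1 X ?\<sigma>" by (rule singular_simplex_path_simplex[OF p(1)])
    have faces: "frag_of (singular_face 1 0 ?\<sigma>) = pt (p 1)" "frag_of (singular_face 1 1 ?\<sigma>) = pt (p 0)"
    proof -
      have v0: "x 0 = 1" if "x \<in> standard_simplex 0" for x
        using that by (simp add: standard_simplex_def)
      have "simplical_face k x \<in> standard_simplex 1" if "x \<in> standard_simplex 0" "k \<le> 1" for x :: "nat \<Rightarrow> real" and k
        using simplical_face_in_standard_simplex[of 1 k x] that by simp
      then show "frag_of (singular_face 1 0 ?\<sigma>) = pt (p 1)" "frag_of (singular_face 1 1 ?\<sigma>) = pt (p 0)"
        unfolding pt_def singular_face_def path_simplex_def
        by (auto intro!: arg_cong[of _ _ frag_of] simp: fun_eq_iff restrict_def v0) (auto simp: simplical_face_def v0)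
    qed
    have sing: "singular_chain 0 X (pt (p 1))" "singular_chain 0 X (pt (p 0))"
      using singular_simplex_singular_face[OF \<sigma>, of 0] singular_simplex_singular_face[OF \<sigma>, of 1]
      by (simp_all add: singular_chain_of flip: faces)
    have "turning_cochain u ?\<sigma> = c (frag_of ?\<sigma>)"
      using \<sigma> by (simp add: c_def singular_chain_of)
    also have "\<dots> = b (chain_boundary 1 (frag_of ?\<sigma>))"
      using \<sigma> by (simp add: b(2) singular_coboundary_map_def singular_chain_of)
    also have "chain_boundary 1 (frag_of ?\<sigma>) = pt (p 1) - pt (p 0)"
      using faces by (simp add: chain_boundary_of)
    also have "b (pt (p 1) - pt (p 0)) = b (pt (p 1)) - b (pt (p 0))"
      by (rule b_diff[OF sing])
    finally have eq: "turning_cochain u ?\<sigma> = b (pt (p 1)) - b (pt (p 0))" .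
    have edge: "?\<sigma> (edge_point t) = p t" if "t \<in> {0..1}" for t
      using edge_point_in_simplex[OF that] by (simp add: path_simplex_def edge_point_def)
    show ?thesis
      using turning_cochain_eq[of k u ?\<sigma>] p(2,3) edge edge[of 0] edge[of 1] by (simp add: eq)
  qed
  show ?thesis
    using path[OF \<alpha>] path[OF \<beta>] loop by (simp add: algebra_simps)
qed

section \<open>A two-sided non-separating continuum in a manifold\<close>

lemma topological_manifold_imp_locally_path_connected:
  assumes "topological_manifold n X" shows "locally_path_connected_space X"
  unfolding locally_path_connected_space
proof (intro allI impI)
  fix V x assume V: "openin X V \<and> x \<in> V"
  then have "x \<in> topspace X" using openin_subset by blast
  then obtain U E where U: "openin X U" "x \<in> U" and E: "openin (Euclidean_space n) E"
    and hom: "subtopology X U homeomorphic_space subtopology (Euclidean_space n) E"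
    using assms unfolding topological_manifold_def by metis
  have "locally_path_connected_space (subtopology X U)"
    using homeomorphic_locally_path_connected_space[OF hom]
      locally_path_connected_space_open_subset[OF locally_path_connected_Euclidean_space E] by blast
  moreover have "openin (subtopology X U) (U \<inter> V)" using V by (simp add: openin_subtopology_Int2)
  ultimately obtain G where G: "openin (subtopology X U) G" "path_connectedin (subtopology X U) G"
    "x \<in> G" "G \<subseteq> U \<inter> V"
    using V U unfolding locally_path_connected_space by (metis IntI)
  then show "\<exists>G. openin X G \<and> path_connectedin X G \<and> x \<in> G \<and> G \<subseteq> V"
    using U(1) by (intro exI[of _ G]) (auto simp: openin_open_subtopology path_connectedin_subtopology)
qed

text \<open>A loop that crosses \<open>K\<close> once is not homologically trivial.  The circle-valued map \<open>u\<close> is \<open>1\<close> away from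
  \<open>K\<close> and turns once when \<open>K\<close> is crossed from \<open>P\<close> to \<open>P'\<close>.  Go from \<open>P\<close> to \<open>P'\<close> inside the neighborhood
  of \<open>K\<close>, and return in the connected complement of \<open>K\<close>.  Explicit lifts of \<open>u\<close> on these two sets show
  that \<open>u\<close> has turning \<open>2 \<pi>\<close> along the loop.\<close>

lemma H1_nontrivial_if_two_sided_nonseparating:
  fixes K :: "'a::metric_space set"
  assumes lpc: "locally_path_connected_space (euclidean :: 'a topology)"
    and K: "compact K" "connected K" "K \<noteq> {}" and sides: "two_sided K P P'"
    and accum: "\<And>V. neighborhood K V \<Longrightarrow> V \<inter> P \<noteq> {}" "\<And>V. neighborhood K V \<Longrightarrow> V \<inter> P' \<noteq> {}"
    and nonsep: "connected (UNIV - K)"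
  shows "\<not> trivial_group (singular_cohomology_group 1 (euclidean :: 'a topology))"
proof
  assume triv: "trivial_group (singular_cohomology_group 1 (euclidean :: 'a topology))"
  define O' where "O' = K \<union> P \<union> P'"
  have P: "open P" "open P'" "open O'" "K \<inter> P = {}" "K \<inter> P' = {}" "P \<inter> P' = {}"
    using sides by (auto simp: two_sided_def O'_def)
  have clK: "closed K" using K(1) by (rule compact_imp_closed)
  have lpc_open: "locally_path_connected_space (top_of_set S)" if "open S" for S :: "'a set"
    using locally_path_connected_space_open_subset[OF lpc] that by simp
  obtain k where k: "k \<in> K" using K(3) by blast
  \<comment> \<open>\<open>K\<close> itself may contain no path; the crossing path runs in an open path component around it.\<close>
  define C where "C = {x. path_component_of (top_of_set O') k x}"
  have "openin (top_of_set O') C"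
    unfolding C_def by (intro openin_path_component_of_locally_path_connected_space lpc_open P)
  then have "open C" using P(3) by (simp add: openin_open_eq)
  moreover have "K \<subseteq> C"
  proof
    fix x assume "x \<in> K"
    have "connectedin (top_of_set O') K"
      using K(2) by (auto simp: connectedin_subtopology O'_def)
    then have "connected_component_of (top_of_set O') k x"
      using k \<open>x \<in> K\<close> unfolding connected_component_of_def by blast
    then show "x \<in> C"
      unfolding C_def using path_component_eq_connected_component_of[OF lpc_open[OF P(3)]]
      by (metis mem_Collect_eq)
  qed
  ultimately have "neighborhood K C" by (simp add: neighborhood_def interior_open)
  then obtain p p' where p: "p \<in> C" "p \<in> P" and p': "p' \<in> C" "p' \<in> P'" using accum by blast
  have "path_component_of (top_of_set O') p p'"
    using p(1) p'(1) unfolding C_def by (metis mem_Collect_eq path_component_of_sym path_component_of_trans)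
  then obtain \<alpha> where \<alpha>: "pathin (top_of_set O') \<alpha>" "\<alpha> 0 = p" "\<alpha> 1 = p'"
    unfolding path_component_of_def by blast
  have openK: "open (UNIV - K)" using clK by (simp add: open_Diff)
  have "path_connected_space (top_of_set (UNIV - K))"
    using path_connected_eq_connected_space[OF lpc_open[OF openK]] nonsep
    by (metis connected_space_subtopology connectedin_iff_connected)
  moreover have "p \<in> UNIV - K" "p' \<in> UNIV - K" using p p' P by auto
  ultimately obtain \<beta> where \<beta>: "pathin (top_of_set (UNIV - K)) \<beta>" "\<beta> 0 = p'" "\<beta> 1 = p"
    unfolding path_connected_space_def by force
  obtain e where e: "e > 0" "(\<Union>x\<in>K. ball x e) \<subseteq> O'"
    using compact_subset_open_imp_ball_epsilon_subset[OF K(1) P(3)] by (auto simp: O'_def)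
  define F where "F = {x. infdist x K > e / 2}"
  have openF: "open F" unfolding F_def by (intro open_Collect_less continuous_intros)
  have cover: "x \<in> O'" if "x \<notin> F" for x
  proof -
    have "infdist x K < e" using that e by (simp add: F_def)
    then show ?thesis using ball_of_infdist_less[OF K(3)] e(2) by blast
  qed
  \<comment> \<open>\<open>d\<close> is positive on \<open>P'\<close>, negative on \<open>P\<close> and zero elsewhere; \<open>a\<close> rescales it to reach
    \<open>-1\<close> and \<open>1\<close> at distance \<open>e / 2\<close> from \<open>K\<close>.  So \<open>\<pi> + \<pi> a\<close> rises from \<open>0\<close> to \<open>2 \<pi>\<close> across \<open>K\<close>.\<close>
  define d where "d x = infdist x (- P') - infdist x (- P)" for x
  define h where "h x = max 0 (e / 2 - infdist x K)" for x
  define a where "a x = d x / (\<bar>d x\<bar> + h x)" for x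
  have kP: "k \<in> - P" "k \<in> - P'" using k P by auto
  have d_pos: "d x > 0" if "x \<in> P'" for x
  proof -
    have "infdist x (- P') > 0" using that P kP by (intro infdist_pos_not_in_closed) auto
    moreover have "x \<in> - P" using that P by auto
    ultimately show ?thesis by (simp add: d_def)
  qed
  have d_neg: "d x < 0" if "x \<in> P" for x
  proof -
    have "infdist x (- P) > 0" using that P kP by (intro infdist_pos_not_in_closed) auto
    moreover have "x \<in> - P'" using that P by auto
    ultimately show ?thesis by (simp add: d_def)
  qed
  have pos: "\<bar>d x\<bar> + h x \<noteq> 0" if "x \<in> O'" for x
  proof (cases "x \<in> K")
    case True
    then have "h x > 0" using e by (simp add: h_def)
    then show ?thesis by linarith
  next
    case False
    then have "\<bar>d x\<bar> > 0" using d_pos[of x] d_neg[of x] that by (auto simp: O'_def)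
    moreover have "h x \<ge> 0" by (simp add: h_def)
    ultimately show ?thesis by linarith
  qed
  have acont: "continuous_on O' a"
    unfolding a_def d_def h_def
    by (intro continuous_intros) (use pos in \<open>auto simp: d_def h_def\<close>)
  define sg :: "'a \<Rightarrow> real" where "sg x = (if x \<in> P' then 1 else if x \<in> P then -1 else 0)" for x
  have aF: "a x = sg x" if "x \<in> F" for x
  proof -
    have h0: "h x = 0" using that by (simp add: F_def h_def)
    have "d x = 0" if "x \<notin> P" "x \<notin> P'" using that by (simp add: d_def)
    then show ?thesis
      using d_pos[of x] d_neg[of x] P by (auto simp: a_def sg_def h0)
  qed
  define u where "u x = (if x \<in> O' then cis (pi + pi * a x) else 1)" for x
  \<comment> \<open>A second lift of \<open>u\<close>, on the complement of \<open>K\<close>: it is \<open>\<pi> + \<pi> a\<close> on \<open>P\<close>, smaller by \<open>2 \<pi>\<close> on \<open>P'\<close>,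
    and zero far from \<open>K\<close>.\<close>
  define \<theta> where "\<theta> x = pi * (a x - sg x)" for x
  have u\<theta>: "u x = cis (\<theta> x)" if "x \<notin> K" for x
  proof -
    have "cis (pi + pi * a x) = cis (pi * a x - pi)"
      by (auto simp: cis_eq_iff_int intro!: exI[of _ 1])
    moreover have "x \<in> F" if "x \<notin> O'" using cover that by blast
    ultimately show ?thesis
      using that aF[of x] P by (auto simp: u_def \<theta>_def sg_def O'_def algebra_simps)
  qed
  have \<theta>cont: "continuous_on (UNIV - K) \<theta>"
  proof -
    have "continuous_on P \<theta>"
    proof (rule continuous_on_eq)
      show "continuous_on P (\<lambda>x. pi * (a x + 1))"
        by (intro continuous_intros continuous_on_subset[OF acont]) (auto simp: O'_def)
    qed (use P in \<open>auto simp: \<theta>_def sg_def\<close>)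
    moreover have "continuous_on P' \<theta>"
    proof (rule continuous_on_eq)
      show "continuous_on P' (\<lambda>x. pi * (a x - 1))"
        by (intro continuous_intros continuous_on_subset[OF acont]) (auto simp: O'_def)
    qed (auto simp: \<theta>_def sg_def)
    moreover have "continuous_on F \<theta>"
      by (rule continuous_on_eq[of _ "\<lambda>_. 0"]) (auto simp: \<theta>_def aF)
    ultimately have "continuous_on (P \<union> P' \<union> F) \<theta>"
      using P openF by (intro continuous_on_open_Un) auto
    moreover have "UNIV - K \<subseteq> P \<union> P' \<union> F" using cover by (auto simp: O'_def)
    ultimately show ?thesis by (rule continuous_on_subset)
  qed
  have "continuous_on (UNIV - K) u"
    by (rule continuous_on_eq[of _ "\<lambda>x. cis (\<theta> x)"]) (use u\<theta> \<theta>cont in \<open>auto intro!: continuous_intros\<close>)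
  moreover have "continuous_on O' u"
    by (rule continuous_on_eq[of _ "\<lambda>x. cis (pi + pi * a x)"])
      (use acont in \<open>auto simp: u_def intro!: continuous_intros\<close>)
  ultimately have "continuous_on ((UNIV - K) \<union> O') u"
    using P openK by (intro continuous_on_open_Un) auto
  moreover have "(UNIV - K) \<union> O' = UNIV" by (auto simp: O'_def)
  ultimately have u: "continuous_map euclidean euclidean u" by simp
  have u1: "norm (u x) = 1" for x by (simp add: u_def)
  have \<alpha>': "continuous_on {0..1} \<alpha>" "\<alpha> ` {0..1} \<subseteq> O'" and \<beta>': "continuous_on {0..1} \<beta>" "\<beta> ` {0..1} \<subseteq> UNIV - K"
    using \<alpha>(1) \<beta>(1) by (auto simp: pathin_def continuous_map_in_subtopology)
  let ?g = "\<lambda>t. pi + pi * a (\<alpha> t)" and ?h = "\<lambda>t. \<theta> (\<beta> t)"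
  have "(?g 1 - ?g 0) + (?h 1 - ?h 0) = 0"
  proof (rule turning_of_loop_zero_if_H1_trivial[OF triv u, of \<alpha> ?g \<beta> ?h])
    show "continuous_on {0..1} ?g"
      using \<alpha>' by (intro continuous_intros continuous_on_compose2[OF acont]) auto
    show "u (\<alpha> t) = cis (pi + pi * a (\<alpha> t))" if "t \<in> {0..1}" for t
    proof -
      have "\<alpha> t \<in> O'" using \<alpha>'(2) that by blast
      then show ?thesis by (simp add: u_def)
    qed
    show "continuous_on {0..1} ?h"
      using \<beta>' by (intro continuous_on_compose2[OF \<theta>cont]) auto
    show "u (\<beta> t) = cis (\<theta> (\<beta> t))" if "t \<in> {0..1}" for t
      using \<beta>'(2) that by (intro u\<theta>) blast
  qed (use \<alpha> \<beta> \<alpha>' \<beta>' u1 in \<open>auto simp: pathin_def\<close>)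
  moreover have "sg p = -1" "sg p' = 1" using p(2) p'(2) P by (auto simp: sg_def)
  ultimately have "2 * pi = 0"
    by (simp add: \<alpha> \<beta> \<theta>_def algebra_simps)
  then show False by simp
qed

section \<open>Continua with two sides and trivial first indices\<close>

theorem theorem27:
  fixes \<phi> :: "'a::metric_space \<Rightarrow> real \<Rightarrow> 'a"
    and K W :: "'a set"
  assumes "connected (UNIV :: 'a set)"
    and "locally_compact_space (euclidean :: 'a topology)"
    and "flow \<phi>"
    and "isolated_invariant_set \<phi> K"
    and "connected K"
    and "neighborhood K W"
    and "connected W"
    and "card (components (W - K)) = 2"
    and "trivial_CH_plus 1 \<phi> K"
    and "trivial_CH_minus 1 \<phi> K"
  shows "non_saddle \<phi> K \<and> \<not> attractor \<phi> K \<and> \<not> repeller \<phi> K \<and>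
    (compact (UNIV :: 'a set) \<and> (\<exists>n. topological_manifold n (euclidean :: 'a topology)) \<and>
       connected (UNIV - K)
     \<longrightarrow> \<not> trivial_group (singular_cohomology_group 1 (euclidean :: 'a topology)))"
proof -
  have K: "compact K" "K \<noteq> {}" using assms(4) by (auto simp: isolated_invariant_set_def)
  obtain P P' where P: "two_sided K P P'"
    "\<And>V. neighborhood K V \<Longrightarrow> V \<inter> P \<noteq> {}" "\<And>V. neighborhood K V \<Longrightarrow> V \<inter> P' \<noteq> {}"
    using two_components_give_two_sides[OF assms(7,6) compact_imp_closed[OF K(1)] K(2) assms(8)] by metis
  have "non_saddle \<phi> K \<and> \<not> attractor \<phi> K \<and> \<not> repeller \<phi> K"
    by (rule non_saddle_if_indices_trivial[OF assms(3) K(1) assms(5) P assms(9,10)])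
  moreover have "\<not> trivial_group (singular_cohomology_group 1 (euclidean :: 'a topology))"
    if "topological_manifold n (euclidean :: 'a topology)" "connected (UNIV - K)" for n
    using H1_nontrivial_if_two_sided_nonseparating[OF
        topological_manifold_imp_locally_path_connected[OF that(1)] K(1) assms(5) K(2) P that(2)] .
  ultimately show ?thesis by blast
qed

end
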